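(* The inference system $\mathbf{ReC}^{\to}_\lor$ admits equational derivability (ED). That is, for every substitution $\theta$, every set of equations $\mathcal{C}$, every equation $l\simeq r$ and every clause $D[l\theta]$: if $\mathcal{C}\vdash^*_{\mathbf{ReC}^{\to}_\lor} D[l\theta]$, then $\mathcal{C},\,l\simeq r\vdash^*_{\mathbf{ReC}^{\to}_\lor} D[r\theta]$.
   Context: Setting: (many-sorted) first-order logic with equality $\simeq$. Equations are unordered, so a rule stated for $l\simeq r$ can be applied with either side as $l$. $\bowtie$ stands for $\simeq$ or $\not\simeq$. A clause is a disjunction of literals. $E[s]_p$ denotes an expression $E$ with a distinguished occurrence of the term $s$ at position $p$ ($p$ omitted if irrelevant), and $E[t]_p$ is the result of replacing this occurrence by $t$. $\succ$ is a fixed reduction ordering (well-founded, stable under substitutions and contexts) that is total on ground terms; it is extended to literals and clauses by the bag (multiset) extension. A literal selection function satisfying the usual condition w.r.t. $\succ$ for superposition is fixed. For an inference system $\mathcal{I}$, $\mathcal{C}\vdash^*_{\mathcal{I}}D$ means that $D$ is derivable from the clauses $\mathcal{C}$ by finitely many inferences of $\mathcal{I}$. A position is a finite sequence of positive integers; $\epsilon$ is the empty one. $p<_l q$ ("$p$ is to the left of $q$") if there are positive integers $i<j$ and positions $r,p',q'$ with $p=rip'$ and $q=rjq'$. Every clause carries a position annotation $p$ (position of the previous rewrite) and one of the annotations $\blacksquare$ (result of an upward rewrite) or $\square$ (any other clause), written ${}^{\blacksquare}{}_pC$ or ${}^{\square}{}_pC$. Input clauses are annotated with $\square$ and $\epsilon$.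 An unannotated clause counts as derivable if it is derivable with some annotation. $\mathbf{ReC}^{\to}_\lor$ consists of the following rules. (Sup) From ${}^{\square}{}_p(s[u]\bowtie t\lor C)$ and ${}^{\square}{}_q(l\simeq r\lor D)$ (displayed literals selected) infer ${}^{\square}{}_\epsilon(s[r]\bowtie t\lor C\lor D)\theta$, where $u$ is not a variable, $\theta=\mathrm{mgu}(l,u)$, $r\theta\not\succeq l\theta$ and $t\theta\not\succeq s\theta$. (EqRes) From ${}^{\square}{}_p(s\not\simeq t\lor C)$ ($s\not\simeq t$ selected) infer ${}^{\square}{}_\epsilon C\theta$, where $\theta=\mathrm{mgu}(s,t)$. (EqFac) From ${}^{\square}{}_p(s\simeq t\lor u\simeq w\lor C)$ (both displayed literals selected) infer ${}^{\square}{}_\epsilon(s\simeq t\lor t\not\simeq w\lor C)\theta$, where $\theta=\mathrm{mgu}(s,u)$, $t\theta\not\succeq s\theta$ and $w\theta\not\succeq t\theta$. ($\mathrm{Rw}^{\to}_\downarrow$) From ${}^{\square}{}_pC[l\theta]_q$ and ${}^{\square}(l\simeq r)$ (any position annotation) infer ${}^{\square}{}_qC[r\theta]_q$, where $l\theta\not\preceq r\theta$ and $q\not<_l p$. ($\mathrm{Rw}^{\to}_\uparrow$) From ${}_pC[l\theta]_q$ with either annotation $\square$ or $\blacksquare$, and ${}^{\square}(l\simeq r)$ (any position annotation), infer ${}^{\blacksquare}{}_qC[r\theta]_q$, where (1) $l\theta\not\succeq r\theta$ and (2) the first premise is annotated $\square$ or $q\not<_l p$. Here $\theta$ is a substitution.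 *)

theory Defs
  imports Complex_Main "HOL-Library.Multiset"
begin

section \<open>Many-sorted terms, substitutions and unifiers\<close>

datatype ('f, 'v) trm = Var 'v | Fun 'f "('f, 'v) trm list"

record ('f, 'v, 's) signature =
  arg_sorts :: "'f \<Rightarrow> 's list"
  res_sort :: "'f \<Rightarrow> 's"
  var_sort :: "'v \<Rightarrow> 's"

fun sort_of :: "('f, 'v, 's) signature \<Rightarrow> ('f, 'v) trm \<Rightarrow> 's" where
  "sort_of \<Sigma> (Var x) = var_sort \<Sigma> x"
| "sort_of \<Sigma> (Fun f ts) = res_sort \<Sigma> f"

fun well_sorted :: "('f, 'v, 's) signature \<Rightarrow> ('f, 'v) trm \<Rightarrow> bool" where
  "well_sorted \<Sigma> (Var x) \<longleftrightarrow> True"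
| "well_sorted \<Sigma> (Fun f ts) \<longleftrightarrow>
     map (sort_of \<Sigma>) ts = arg_sorts \<Sigma> f \<and> (\<forall>t\<in>set ts. well_sorted \<Sigma> t)"

fun vars_trm :: "('f, 'v) trm \<Rightarrow> 'v set" where
  "vars_trm (Var x) = {x}"
| "vars_trm (Fun f ts) = (\<Union>t\<in>set ts. vars_trm t)"

definition ground :: "('f, 'v) trm \<Rightarrow> bool" where
  "ground t \<longleftrightarrow> vars_trm t = {}"

text \<open>
  The usual conventions of many-sorted first-order logic: the sorts are the elements of the type
  \<^typ>\<open>'s\<close>, there are infinitely many variables of every sort (so that premises can be renamed
  apart), and every sort is inhabited, i.e. has a ground term.
\<close>

definition wf_signature :: "('f, 'v, 's) signature \<Rightarrow> bool" where
  "wf_signature \<Sigma> \<longleftrightarrow>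
     (\<forall>s. infinite {x. var_sort \<Sigma> x = s}) \<and>
     (\<forall>s. \<exists>t. well_sorted \<Sigma> t \<and> ground t \<and> sort_of \<Sigma> t = s)"

type_synonym ('f, 'v) subst = "'v \<Rightarrow> ('f, 'v) trm"

fun subst_trm :: "('f, 'v) trm \<Rightarrow> ('f, 'v) subst \<Rightarrow> ('f, 'v) trm" (infixl "\<cdot>" 67) where
  "Var x \<cdot> \<sigma> = \<sigma> x"
| "Fun f ts \<cdot> \<sigma> = Fun f (map (\<lambda>t. t \<cdot> \<sigma>) ts)"

definition substitution :: "('f, 'v, 's) signature \<Rightarrow> ('f, 'v) subst \<Rightarrow> bool" where
  "substitution \<Sigma> \<sigma> \<longleftrightarrow> (\<forall>x. well_sorted \<Sigma> (\<sigma> x) \<and> sort_of \<Sigma> (\<sigma> x) = var_sort \<Sigma> x)"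

definition renaming :: "('f, 'v, 's) signature \<Rightarrow> ('f, 'v) subst \<Rightarrow> bool" where
  "renaming \<Sigma> \<rho> \<longleftrightarrow> substitution \<Sigma> \<rho> \<and> (\<exists>\<pi>. bij \<pi> \<and> \<rho> = (\<lambda>x. Var (\<pi> x)))"

definition is_mgu ::
  "('f, 'v, 's) signature \<Rightarrow> ('f, 'v) subst \<Rightarrow> ('f, 'v) trm \<Rightarrow> ('f, 'v) trm \<Rightarrow> bool" where
  "is_mgu \<Sigma> \<theta> s t \<longleftrightarrow>
     substitution \<Sigma> \<theta> \<and> s \<cdot> \<theta> = t \<cdot> \<theta> \<and>
     (\<forall>\<tau>. substitution \<Sigma> \<tau> \<and> s \<cdot> \<tau> = t \<cdot> \<tau> \<longrightarrow>
        (\<exists>\<delta>. substitution \<Sigma> \<delta> \<and> (\<forall>x. \<tau> x = \<theta> x \<cdot> \<delta>)))"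


section \<open>Literals and clauses\<close>

text \<open>
  A clause is kept in the form in which it is written, as a list of literals with a left-hand and a
  right-hand side, since positions refer to this form. The inference rules below treat literals as
  unordered: \<open>same_lit L (Lit b s t)\<close> says that \<open>L\<close> can be displayed as \<open>s \<simeq> t\<close> (if \<open>b\<close>) or
  \<open>s \<not>\<simeq> t\<close> (if \<open>\<not> b\<close>).
\<close>

datatype ('f, 'v) lit = Lit (is_pos: bool) (lhs: "('f, 'v) trm") (rhs: "('f, 'v) trm")

type_synonym ('f, 'v) clause = "('f, 'v) lit list"

definition same_lit :: "('f, 'v) lit \<Rightarrow> ('f, 'v) lit \<Rightarrow> bool" where
  "same_lit L K \<longleftrightarrow> L = K \<or> L = Lit (is_pos K) (rhs K) (lhs K)"

definition is_equation :: "('f, 'v) clause \<Rightarrow> ('f, 'v) trm \<Rightarrow> ('f, 'v) trm \<Rightarrow> bool" where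
  "is_equation E l r \<longleftrightarrow> (\<exists>L. E = [L] \<and> same_lit L (Lit True l r))"

definition well_sorted_clause :: "('f, 'v, 's) signature \<Rightarrow> ('f, 'v) clause \<Rightarrow> bool" where
  "well_sorted_clause \<Sigma> C \<longleftrightarrow>
     (\<forall>L\<in>set C. well_sorted \<Sigma> (lhs L) \<and> well_sorted \<Sigma> (rhs L) \<and>
                sort_of \<Sigma> (lhs L) = sort_of \<Sigma> (rhs L))"

definition vars_clause :: "('f, 'v) clause \<Rightarrow> 'v set" where
  "vars_clause C = (\<Union>L\<in>set C. vars_trm (lhs L) \<union> vars_trm (rhs L))"

definition subst_clause :: "('f, 'v) clause \<Rightarrow> ('f, 'v) subst \<Rightarrow> ('f, 'v) clause" where
  "subst_clause C \<sigma> = map (\<lambda>L. Lit (is_pos L) (lhs L \<cdot> \<sigma>) (rhs L \<cdot> \<sigma>)) C"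


section \<open>Positions\<close>

type_synonym pos = "nat list"

definition left_of :: "pos \<Rightarrow> pos \<Rightarrow> bool" where
  "left_of p q \<longleftrightarrow>
     (\<exists>i j r p' q'. 0 < i \<and> i < j \<and> p = r @ i # p' \<and> q = r @ j # q')"

text \<open>
  Positions count from 1. In a clause, the first number selects the literal, the second one the side
  of the literal, and the rest is a position in the term on that side.
\<close>

fun trm_at :: "('f, 'v) trm \<Rightarrow> pos \<Rightarrow> ('f, 'v) trm option" where
  "trm_at t [] = Some t"
| "trm_at (Var x) (i # p) = None"
| "trm_at (Fun f ts) (i # p) =
     (if 1 \<le> i \<and> i \<le> length ts then trm_at (ts ! (i - 1)) p else None)"

fun put_trm :: "('f, 'v) trm \<Rightarrow> pos \<Rightarrow> ('f, 'v) trm \<Rightarrow> ('f, 'v) trm" where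
  "put_trm t [] u = u"
| "put_trm (Var x) (i # p) u = Var x"
| "put_trm (Fun f ts) (i # p) u =
     (if 1 \<le> i \<and> i \<le> length ts
      then Fun f (ts[i - 1 := put_trm (ts ! (i - 1)) p u]) else Fun f ts)"

fun lit_at :: "('f, 'v) lit \<Rightarrow> pos \<Rightarrow> ('f, 'v) trm option" where
  "lit_at (Lit b s t) [] = None"
| "lit_at (Lit b s t) (i # p) =
     (if i = 1 then trm_at s p else if i = 2 then trm_at t p else None)"

fun put_lit :: "('f, 'v) lit \<Rightarrow> pos \<Rightarrow> ('f, 'v) trm \<Rightarrow> ('f, 'v) lit" where
  "put_lit (Lit b s t) [] u = Lit b s t"
| "put_lit (Lit b s t) (i # p) u =
     (if i = 1 then Lit b (put_trm s p u) t
      else if i = 2 then Lit b s (put_trm t p u) else Lit b s t)"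

fun clause_at :: "('f, 'v) clause \<Rightarrow> pos \<Rightarrow> ('f, 'v) trm option" where
  "clause_at C [] = None"
| "clause_at C (i # p) =
     (if 1 \<le> i \<and> i \<le> length C then lit_at (C ! (i - 1)) p else None)"

fun put_clause :: "('f, 'v) clause \<Rightarrow> pos \<Rightarrow> ('f, 'v) trm \<Rightarrow> ('f, 'v) clause" where
  "put_clause C [] u = C"
| "put_clause C (i # p) u =
     (if 1 \<le> i \<and> i \<le> length C then C[i - 1 := put_lit (C ! (i - 1)) p u] else C)"


section \<open>Orderings and literal selection\<close>

definition reduction_ordering ::
  "('f, 'v, 's) signature \<Rightarrow> (('f, 'v) trm \<Rightarrow> ('f, 'v) trm \<Rightarrow> bool) \<Rightarrow> bool" where
  "reduction_ordering \<Sigma> gt \<longleftrightarrow>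
     (\<forall>s t. gt s t \<longrightarrow> well_sorted \<Sigma> s \<and> well_sorted \<Sigma> t) \<and>
     transp gt \<and>
     wfp (\<lambda>s t. gt t s) \<and>
     (\<forall>s t \<sigma>. gt s t \<and> substitution \<Sigma> \<sigma> \<longrightarrow> gt (s \<cdot> \<sigma>) (t \<cdot> \<sigma>)) \<and>
     (\<forall>u p s t. gt s t \<and> trm_at u p \<noteq> None \<and>
        well_sorted \<Sigma> (put_trm u p s) \<and> well_sorted \<Sigma> (put_trm u p t) \<longrightarrow>
        gt (put_trm u p s) (put_trm u p t))"

definition total_on_ground ::
  "('f, 'v, 's) signature \<Rightarrow> (('f, 'v) trm \<Rightarrow> ('f, 'v) trm \<Rightarrow> bool) \<Rightarrow> bool" where
  "total_on_ground \<Sigma> gt \<longleftrightarrow>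
     (\<forall>s t. well_sorted \<Sigma> s \<and> well_sorted \<Sigma> t \<and> ground s \<and> ground t \<longrightarrow>
        s = t \<or> gt s t \<or> gt t s)"

definition geq ::
  "(('f, 'v) trm \<Rightarrow> ('f, 'v) trm \<Rightarrow> bool) \<Rightarrow> ('f, 'v) trm \<Rightarrow> ('f, 'v) trm \<Rightarrow> bool" where
  "geq gt s t \<longleftrightarrow> gt s t \<or> s = t"

text \<open>
  Bag extension to literals: \<open>s \<simeq> t\<close> is compared as the multiset \<open>{s, t}\<close> and \<open>s \<not>\<simeq> t\<close> as
  \<open>{s, s, t, t}\<close>. Note that \<^const>\<open>multp\<close> extends the \<^emph>\<open>smaller\<close> relation.
\<close>

definition mset_lit :: "('f, 'v) lit \<Rightarrow> ('f, 'v) trm multiset" where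
  "mset_lit L =
     (if is_pos L then {#lhs L, rhs L#} else {#lhs L, lhs L, rhs L, rhs L#})"

definition lit_gt ::
  "(('f, 'v) trm \<Rightarrow> ('f, 'v) trm \<Rightarrow> bool) \<Rightarrow> ('f, 'v) lit \<Rightarrow> ('f, 'v) lit \<Rightarrow> bool" where
  "lit_gt gt L K \<longleftrightarrow> multp (\<lambda>s t. gt t s) (mset_lit K) (mset_lit L)"

definition maximal_lits ::
  "(('f, 'v) trm \<Rightarrow> ('f, 'v) trm \<Rightarrow> bool) \<Rightarrow> ('f, 'v) clause \<Rightarrow> nat set" where
  "maximal_lits gt C =
     {i. i < length C \<and> \<not> (\<exists>j < length C. lit_gt gt (C ! j) (C ! i))}"

text \<open>
  A selection function returns the indices of the selected literals. The usual condition for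
  superposition: in every nonempty clause, some negative literal is selected or all maximal literals
  are selected.
\<close>

definition selection_function ::
  "('f, 'v, 's) signature \<Rightarrow> (('f, 'v) trm \<Rightarrow> ('f, 'v) trm \<Rightarrow> bool) \<Rightarrow>
   (('f, 'v) clause \<Rightarrow> nat set) \<Rightarrow> bool" where
  "selection_function \<Sigma> gt sel \<longleftrightarrow>
     (\<forall>C. well_sorted_clause \<Sigma> C \<longrightarrow>
        sel C \<subseteq> {..<length C} \<and>
        (C \<noteq> [] \<longrightarrow> (\<exists>i\<in>sel C. \<not> is_pos (C ! i)) \<or> maximal_lits gt C \<subseteq> sel C))"


section \<open>The inference system\<close>

text \<open>
  \<open>Upward\<close> is the annotation of the results of upward rewrites, \<open>Plain\<close> that of all other clauses.
  \<open>ReC \<Sigma> gt sel N a p C\<close> means that \<open>C\<close>, annotated with \<open>a\<close> and the position \<open>p\<close>, is derivable from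
  the input clauses \<open>N\<close>. The variables of the second premise of superposition are renamed apart from
  those of the first one.
\<close>

datatype annot = Plain | Upward

inductive ReC ::
  "('f, 'v, 's) signature \<Rightarrow> (('f, 'v) trm \<Rightarrow> ('f, 'v) trm \<Rightarrow> bool) \<Rightarrow>
   (('f, 'v) clause \<Rightarrow> nat set) \<Rightarrow> ('f, 'v) clause set \<Rightarrow>
   annot \<Rightarrow> pos \<Rightarrow> ('f, 'v) clause \<Rightarrow> bool"
  for \<Sigma> gt sel N where
  Input:
    "C \<in> N \<Longrightarrow> ReC \<Sigma> gt sel N Plain [] C"
| Sup:
    "\<lbrakk>ReC \<Sigma> gt sel N Plain p P; ReC \<Sigma> gt sel N Plain q Q\<^sub>0;
      i < length P; i \<in> sel P; same_lit (P ! i) (Lit b s t);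
      j < length Q\<^sub>0; j \<in> sel Q\<^sub>0;
      renaming \<Sigma> \<rho>; Q = subst_clause Q\<^sub>0 \<rho>; vars_clause P \<inter> vars_clause Q = {};
      same_lit (Q ! j) (Lit True l r);
      trm_at s k = Some u; \<nexists>x. u = Var x;
      is_mgu \<Sigma> \<theta> l u;
      \<not> geq gt (r \<cdot> \<theta>) (l \<cdot> \<theta>); \<not> geq gt (t \<cdot> \<theta>) (s \<cdot> \<theta>)\<rbrakk> \<Longrightarrow>
     ReC \<Sigma> gt sel N Plain []
       (subst_clause (Lit b (put_trm s k r) t # nths P (- {i}) @ nths Q (- {j})) \<theta>)"
| EqRes:
    "\<lbrakk>ReC \<Sigma> gt sel N Plain p P;
      i < length P; i \<in> sel P; same_lit (P ! i) (Lit False s t);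
      is_mgu \<Sigma> \<theta> s t\<rbrakk> \<Longrightarrow>
     ReC \<Sigma> gt sel N Plain [] (subst_clause (nths P (- {i})) \<theta>)"
| EqFac:
    "\<lbrakk>ReC \<Sigma> gt sel N Plain p P;
      i < length P; j < length P; i \<noteq> j; i \<in> sel P; j \<in> sel P;
      same_lit (P ! i) (Lit True s t); same_lit (P ! j) (Lit True u w);
      is_mgu \<Sigma> \<theta> s u;
      \<not> geq gt (t \<cdot> \<theta>) (s \<cdot> \<theta>); \<not> geq gt (w \<cdot> \<theta>) (t \<cdot> \<theta>)\<rbrakk> \<Longrightarrow>
     ReC \<Sigma> gt sel N Plain []
       (subst_clause (Lit True s t # Lit False t w # nths P (- {i, j})) \<theta>)"
| RwDown:
    "\<lbrakk>ReC \<Sigma> gt sel N Plain p C; ReC \<Sigma> gt sel N Plain p' E; is_equation E l r;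
      substitution \<Sigma> \<theta>; clause_at C q = Some (l \<cdot> \<theta>);
      \<not> geq gt (r \<cdot> \<theta>) (l \<cdot> \<theta>); \<not> left_of q p\<rbrakk> \<Longrightarrow>
     ReC \<Sigma> gt sel N Plain q (put_clause C q (r \<cdot> \<theta>))"
| RwUp:
    "\<lbrakk>ReC \<Sigma> gt sel N a p C; ReC \<Sigma> gt sel N Plain p' E; is_equation E l r;
      substitution \<Sigma> \<theta>; clause_at C q = Some (l \<cdot> \<theta>);
      \<not> geq gt (l \<cdot> \<theta>) (r \<cdot> \<theta>); a = Plain \<or> \<not> left_of q p\<rbrakk> \<Longrightarrow>
     ReC \<Sigma> gt sel N Upward q (put_clause C q (r \<cdot> \<theta>))"

definition derivable ::
  "('f, 'v, 's) signature \<Rightarrow> (('f, 'v) trm \<Rightarrow> ('f, 'v) trm \<Rightarrow> bool) \<Rightarrow>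
   (('f, 'v) clause \<Rightarrow> nat set) \<Rightarrow> ('f, 'v) clause set \<Rightarrow> ('f, 'v) clause \<Rightarrow> bool" where
  "derivable \<Sigma> gt sel N C \<longleftrightarrow> (\<exists>a p. ReC \<Sigma> gt sel N a p C)"

end

theory Submission
  imports Defs "HOL-Library.Confluence" "HOL-Combinatorics.Transposition"
begin

text \<open>
  From equations only unit equations are derivable, so ED is a statement about equational rewriting.
  Extend \<open>\<succ>\<close> to a well-founded, monotone ordering that is total on all terms, and consider the
  rewrite relation given by the strictly decreasing instances of the \<open>\<square>\<close>-derivable equations. Its
  critical pairs are instances of superposition conclusions and the ordering is total, so it is
  locally confluent, hence confluent by Newman's lemma. Every derivable clause is convertible to a
  \<open>\<square>\<close>-derivable one, and so is the result of rewriting it by an input equation. By the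
  Church-Rosser property they can be connected by downward rewrites followed by upward rewrites,
  which the calculus can perform: the order imposed on positions is achieved by permuting parallel
  rewrites. The calculus only refuses steps that \<open>\<succ>\<close> orients the wrong way, so that
  steps oriented by the extension are always admitted.
\<close>

section \<open>Substitutions\<close>

lemma subst_trm_comp: "t \<cdot> \<sigma> \<cdot> \<tau> = t \<cdot> (\<lambda>x. \<sigma> x \<cdot> \<tau>)"
  by (induction t) auto

lemma subst_trm_cong: "(\<And>x. x \<in> vars_trm t \<Longrightarrow> \<sigma> x = \<tau> x) \<Longrightarrow> t \<cdot> \<sigma> = t \<cdot> \<tau>"
  by (induction t) auto

lemma subst_trm_Var [simp]: "t \<cdot> Var = t"
  by (induction t) (auto simp: map_idI)

lemma finite_vars_trm [simp]: "finite (vars_trm t)"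
  by (induction t) auto

lemma vars_subst_trm: "vars_trm (t \<cdot> \<sigma>) = (\<Union>x\<in>vars_trm t. vars_trm (\<sigma> x))"
  by (induction t) auto

lemma substitutionD:
  "substitution \<Sigma> \<sigma> \<Longrightarrow> well_sorted \<Sigma> (\<sigma> x)"
  "substitution \<Sigma> \<sigma> \<Longrightarrow> sort_of \<Sigma> (\<sigma> x) = var_sort \<Sigma> x"
  by (auto simp: substitution_def)

lemma sort_of_subst [simp]: "substitution \<Sigma> \<sigma> \<Longrightarrow> sort_of \<Sigma> (t \<cdot> \<sigma>) = sort_of \<Sigma> t"
  by (cases t) (auto simp: substitutionD)

lemma well_sorted_subst [simp]:
  "substitution \<Sigma> \<sigma> \<Longrightarrow> well_sorted \<Sigma> t \<Longrightarrow> well_sorted \<Sigma> (t \<cdot> \<sigma>)"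
  by (induction t) (auto simp: substitutionD o_def)

lemma substitution_Var [simp]: "substitution \<Sigma> Var"
  by (auto simp: substitution_def)

lemma substitution_comp:
  "substitution \<Sigma> \<sigma> \<Longrightarrow> substitution \<Sigma> \<tau> \<Longrightarrow> substitution \<Sigma> (\<lambda>x. \<sigma> x \<cdot> \<tau>)"
  by (auto simp: substitution_def[of _ "\<lambda>x. \<sigma> x \<cdot> \<tau>"] substitutionD)

lemma substitution_upd:
  "substitution \<Sigma> \<sigma> \<Longrightarrow> well_sorted \<Sigma> t \<Longrightarrow> sort_of \<Sigma> t = var_sort \<Sigma> x \<Longrightarrow>
   substitution \<Sigma> (\<sigma>(x := t))"
  by (auto simp: substitution_def)


section \<open>Unification and renaming\<close>

lemma size_subst_le:
  assumes "x \<in> vars_trm t"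
  shows "size (\<tau> x) \<le> size (t \<cdot> \<tau>)"
  using assms
proof (induction t)
  case (Fun f ts)
  then obtain t where t: "t \<in> set ts" "x \<in> vars_trm t" by auto
  then have "size (t \<cdot> \<tau>) \<le> size_list size (map (\<lambda>t. t \<cdot> \<tau>) ts)"
    by (intro size_list_estimation') auto
  with Fun.IH[OF t] show ?case by simp
qed simp

text \<open>If \<open>x\<close> were a proper subterm of \<open>t\<close>, then
  \<open>t \<cdot> \<tau>\<close> would be strictly larger than \<open>\<tau> x\<close>.\<close>

lemma occurs_check:
  assumes "x \<in> vars_trm t" and "\<tau> x = t \<cdot> \<tau>"
  shows "t = Var x"
proof (cases t)
  case (Fun f ts)
  with assms obtain u where u: "u \<in> set ts" "x \<in> vars_trm u" by auto
  then have "size (u \<cdot> \<tau>) \<le> size_list size (map (\<lambda>t. t \<cdot> \<tau>) ts)"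
    by (intro size_list_estimation') auto
  with size_subst_le[OF u(2), of \<tau>] have "size (\<tau> x) < size (t \<cdot> \<tau>)"
    using Fun by simp
  with assms(2) show ?thesis by simp
qed (use assms in auto)

section \<open>Most general unifiers by solving lists of equations\<close>

definition unifier :: "('f, 'v) subst \<Rightarrow> (('f, 'v) trm \<times> ('f, 'v) trm) list \<Rightarrow> bool" where
  "unifier \<tau> es \<longleftrightarrow> (\<forall>(s, t)\<in>set es. s \<cdot> \<tau> = t \<cdot> \<tau>)"

definition vars_problem :: "(('f, 'v) trm \<times> ('f, 'v) trm) list \<Rightarrow> 'v set" where
  "vars_problem es = (\<Union>(s, t)\<in>set es. vars_trm s \<union> vars_trm t)"

definition size_problem :: "(('f, 'v) trm \<times> ('f, 'v) trm) list \<Rightarrow> nat" where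
  "size_problem es = size_list (\<lambda>(s, t). size s) es"

text \<open>That the two sides have equal sorts is not demanded: it follows once a sort-preserving
  unifier exists.\<close>

definition well_sorted_problem ::
  "('f, 'v, 's) signature \<Rightarrow> (('f, 'v) trm \<times> ('f, 'v) trm) list \<Rightarrow> bool" where
  "well_sorted_problem \<Sigma> es \<longleftrightarrow> (\<forall>(s, t)\<in>set es. well_sorted \<Sigma> s \<and> well_sorted \<Sigma> t)"

text \<open>Most generality in the form known from idempotent unifiers: every unifier
  \<open>\<tau>\<close> factors through \<open>\<theta>\<close> with \<open>\<tau>\<close> itself as
  second factor. This form composes when variables are eliminated.\<close>

definition solution ::
  "('f, 'v, 's) signature \<Rightarrow> ('f, 'v) subst \<Rightarrow> (('f, 'v) trm \<times> ('f, 'v) trm) list \<Rightarrow> bool" where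
  "solution \<Sigma> \<theta> es \<longleftrightarrow> substitution \<Sigma> \<theta> \<and> unifier \<theta> es \<and>
     (\<forall>\<tau>. substitution \<Sigma> \<tau> \<longrightarrow> unifier \<tau> es \<longrightarrow> (\<forall>x. \<theta> x \<cdot> \<tau> = \<tau> x))"

abbreviation subst_problem ::
  "('f, 'v) subst \<Rightarrow> (('f, 'v) trm \<times> ('f, 'v) trm) list \<Rightarrow> (('f, 'v) trm \<times> ('f, 'v) trm) list" where
  "subst_problem \<sigma> \<equiv> map (\<lambda>(s, t). (s \<cdot> \<sigma>, t \<cdot> \<sigma>))"

lemma finite_vars_problem [simp]: "finite (vars_problem es)"
  by (auto simp: vars_problem_def)

lemma solution_swap: "solution \<Sigma> \<theta> ((s, t) # es) \<longleftrightarrow> solution \<Sigma> \<theta> ((t, s) # es)"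
  by (auto simp: solution_def unifier_def)

text \<open>A unifier of \<open>(Var x, t) # es\<close> absorbs \<open>Var(x := t)\<close>, since it
  already identifies \<open>x\<close> with \<open>t\<close>; so it unifies the substituted problem
  too and factors through \<open>\<theta>\<close>.\<close>

lemma solution_elim:
  assumes "x \<notin> vars_trm t" "well_sorted \<Sigma> t" "sort_of \<Sigma> t = var_sort \<Sigma> x"
    and "solution \<Sigma> \<theta> (subst_problem (Var(x := t)) es)"
  shows "solution \<Sigma> (\<lambda>y. (Var(x := t)) y \<cdot> \<theta>) ((Var x, t) # es)"
proof -
  let ?\<sigma> = "Var(x := t)"
  have t: "t \<cdot> ?\<sigma> = t"
  proof -
    have "t \<cdot> ?\<sigma> = t \<cdot> Var"
      by (rule subst_trm_cong) (use assms(1) in auto)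
    then show ?thesis by simp
  qed
  have \<theta>: "substitution \<Sigma> \<theta>" "unifier \<theta> (subst_problem ?\<sigma> es)"
    "\<And>\<tau> y. substitution \<Sigma> \<tau> \<Longrightarrow> unifier \<tau> (subst_problem ?\<sigma> es) \<Longrightarrow> \<theta> y \<cdot> \<tau> = \<tau> y"
    using assms(4) by (auto simp: solution_def)
  have sub: "substitution \<Sigma> (\<lambda>y. ?\<sigma> y \<cdot> \<theta>)"
    by (intro substitution_comp substitution_upd) (use assms \<theta> in auto)
  have "unifier (\<lambda>y. ?\<sigma> y \<cdot> \<theta>) ((Var x, t) # es)"
    using \<theta>(2) t subst_trm_comp[of t ?\<sigma> \<theta>]
    by (auto simp: unifier_def subst_trm_comp split: prod.splits)
  moreover have "(?\<sigma> y \<cdot> \<theta>) \<cdot> \<tau> = \<tau> y"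
    if "substitution \<Sigma> \<tau>" "unifier \<tau> ((Var x, t) # es)" for \<tau> y
  proof -
    have eq: "(\<lambda>y. ?\<sigma> y \<cdot> \<tau>) = \<tau>"
      using that(2) by (auto simp: unifier_def)
    have "unifier \<tau> (subst_problem ?\<sigma> es)"
      using that(2) by (auto simp: unifier_def subst_trm_comp eq simp del: fun_upd_apply)
    then have "\<And>y. \<theta> y \<cdot> \<tau> = \<tau> y"
      using \<theta>(3) that(1) by blast
    then show ?thesis using eq by (metis subst_trm_comp subst_trm_cong)
  qed
  ultimately show ?thesis using sub by (simp add: solution_def)
qed

text \<open>Eliminating a variable lowers the number of variables; deletion and decomposition lower
  the size without adding variables. The given unifier \<open>\<tau>\<close> excludes clashes and
  occurs-check failures and forces the sorts to agree.\<close>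

lemma solution_exists:
  assumes "well_sorted_problem \<Sigma> es" "substitution \<Sigma> \<tau>" "unifier \<tau> es"
  shows "\<exists>\<theta>. solution \<Sigma> \<theta> es"
  using assms
proof (induction es rule: wf_induct_rule[OF wf_measures[of "[\<lambda>es. card (vars_problem es), size_problem]"]])
  case (1 es)
  \<comment> \<open>Only the variable set is tied to \<open>es\<close>, so that this also serves a
    first equation that has been turned around.\<close>
  have elim: "\<exists>\<theta>. solution \<Sigma> \<theta> ((Var x, t) # es')"
    if x: "t \<noteq> Var x" and vars: "vars_problem ((Var x, t) # es') = vars_problem es"
      and ws: "well_sorted_problem \<Sigma> ((Var x, t) # es')" and uni: "unifier \<tau> ((Var x, t) # es')"
    for x t es'
  proof -
    let ?\<sigma> = "Var(x := t)"
    from uni have \<tau>: "\<tau> x = t \<cdot> \<tau>" by (simp add: unifier_def)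
    then have nx: "x \<notin> vars_trm t" using occurs_check x by metis
    have sort: "sort_of \<Sigma> t = var_sort \<Sigma> x"
      using \<tau> \<open>substitution \<Sigma> \<tau>\<close> by (metis sort_of_subst substitutionD(2))
    have "vars_trm (s \<cdot> ?\<sigma>) \<subseteq> vars_trm s \<union> vars_trm t - {x}" for s
      using nx by (auto simp: vars_subst_trm split: if_splits)
    then have "vars_problem (subst_problem ?\<sigma> es') \<subseteq> vars_problem ((Var x, t) # es') - {x}"
      using nx by (fastforce simp: vars_problem_def)
    moreover have "x \<in> vars_problem ((Var x, t) # es')"
      by (simp add: vars_problem_def)
    ultimately have less: "card (vars_problem (subst_problem ?\<sigma> es')) < card (vars_problem es)"
      unfolding vars by (intro psubset_card_mono) auto
    have eq: "(\<lambda>y. ?\<sigma> y \<cdot> \<tau>) = \<tau>"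
      using \<tau> by auto
    have "unifier \<tau> (subst_problem ?\<sigma> es')"
      using uni by (auto simp: unifier_def subst_trm_comp eq simp del: fun_upd_apply)
    moreover have sub: "substitution \<Sigma> ?\<sigma>"
      using ws sort by (intro substitution_upd) (auto simp: well_sorted_problem_def)
    moreover have "well_sorted_problem \<Sigma> (subst_problem ?\<sigma> es')"
      using ws sub by (auto simp: well_sorted_problem_def simp del: fun_upd_apply)
    ultimately obtain \<theta> where "solution \<Sigma> \<theta> (subst_problem ?\<sigma> es')"
      using "1.IH"[of "subst_problem ?\<sigma> es'"] less \<open>substitution \<Sigma> \<tau>\<close> by auto
    then have "solution \<Sigma> (\<lambda>y. ?\<sigma> y \<cdot> \<theta>) ((Var x, t) # es')"
      using ws nx sort by (intro solution_elim) (auto simp: well_sorted_problem_def)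
    then show ?thesis by blast
  qed
  show ?case
  proof (cases es)
    case Nil
    then have "solution \<Sigma> Var es" by (simp add: solution_def unifier_def)
    then show ?thesis by blast
  next
    case (Cons e es')
    obtain s t where e: "e = (s, t)" by force
    note es = Cons[unfolded e]
    consider (triv) x where "s = Var x" "t = Var x" | (left) x where "s = Var x" "t \<noteq> Var x"
      | (right) x where "t = Var x" "s \<noteq> Var x" | (funs) f ts g us where "s = Fun f ts" "t = Fun g us"
      by (cases s; cases t) auto
    then show ?thesis
    proof cases
      case triv
      have "vars_problem es' \<subseteq> vars_problem es"
        by (auto simp: es vars_problem_def)
      then have "card (vars_problem es') \<le> card (vars_problem es)"
        by (intro card_mono) auto
      moreover have "size_problem es' < size_problem es"
        by (simp add: es size_problem_def)
      moreover have "unifier \<tau> es'" "well_sorted_problem \<Sigma> es'"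
        using "1.prems" by (auto simp: es unifier_def well_sorted_problem_def)
      ultimately obtain \<theta> where "solution \<Sigma> \<theta> es'"
        using "1.IH"[of es'] "1.prems"(2) by fastforce
      then have "solution \<Sigma> \<theta> es"
        by (auto simp: es triv solution_def unifier_def)
      then show ?thesis by blast
    next
      case left
      then show ?thesis using elim[of t x es'] "1.prems" es by simp
    next
      case right
      have "vars_problem ((Var x, s) # es') = vars_problem es"
        by (auto simp: vars_problem_def es right)
      moreover have "well_sorted_problem \<Sigma> ((Var x, s) # es')" "unifier \<tau> ((Var x, s) # es')"
        using "1.prems" by (auto simp: es right well_sorted_problem_def unifier_def)
      ultimately show ?thesis
        using elim[of s x es'] right es solution_swap by metis
    next
      case funs
      then have eqs: "f = g" "map (\<lambda>t. t \<cdot> \<tau>) ts = map (\<lambda>t. t \<cdot> \<tau>) us"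
        using "1.prems"(3) by (auto simp: es unifier_def)
      have len: "length ts = length us"
        using arg_cong[OF eqs(2), of length] by simp
      let ?es = "zip ts us @ es'"
      have uni_iff: "unifier \<rho> ?es \<longleftrightarrow> unifier \<rho> es" for \<rho>
      proof -
        have "(\<forall>(s, t)\<in>set (zip ts us). s \<cdot> \<rho> = t \<cdot> \<rho>) \<longleftrightarrow>
              map (\<lambda>t. t \<cdot> \<rho>) ts = map (\<lambda>t. t \<cdot> \<rho>) us"
          using len by (induction ts us rule: list_induct2) auto
        then show ?thesis using eqs(1) by (auto simp: unifier_def es funs)
      qed
      have "(\<Union>(s, t)\<in>set (zip ts us). vars_trm s \<union> vars_trm t) =
            (\<Union>t\<in>set ts. vars_trm t) \<union> (\<Union>t\<in>set us. vars_trm t)"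
        using len by (induction ts us rule: list_induct2) auto
      then have vars: "vars_problem ?es = vars_problem es"
        by (simp add: vars_problem_def es funs)
      have "size_list (\<lambda>(s, t). size s) (zip ts us) = size_list size ts"
        using len by (induction ts us rule: list_induct2) auto
      then have size: "size_problem ?es < size_problem es"
        by (simp add: size_problem_def es funs)
      have "well_sorted_problem \<Sigma> ?es"
        using "1.prems"(1) by (auto simp: well_sorted_problem_def es funs dest: set_zip_leftD set_zip_rightD)
      then obtain \<theta> where "solution \<Sigma> \<theta> ?es"
        using "1.IH"[of ?es] "1.prems" uni_iff size vars by auto
      then have "solution \<Sigma> \<theta> es"
        by (simp add: solution_def uni_iff)
      then show ?thesis by blast
    qed
  qed
qed

lemma is_mgu_exists:
  assumes "well_sorted \<Sigma> s" "well_sorted \<Sigma> t" "substitution \<Sigma> \<tau>" "s \<cdot> \<tau> = t \<cdot> \<tau>"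
  shows "\<exists>\<theta>. is_mgu \<Sigma> \<theta> s t"
proof -
  obtain \<theta> where "solution \<Sigma> \<theta> [(s, t)]"
    using solution_exists[of \<Sigma> "[(s, t)]" \<tau>] assms
    by (auto simp: well_sorted_problem_def unifier_def)
  then have "is_mgu \<Sigma> \<theta> s t"
    unfolding is_mgu_def solution_def unifier_def by (simp, metis)
  then show ?thesis by blast
qed

text \<open>By induction on \<open>A\<close>: the image of the next variable is exchanged with a
  fresh variable of the same sort. A transposition keeps the map bijective, as
  \<open>renaming\<close> requires.\<close>

lemma renaming_apart_exists:
  assumes "wf_signature \<Sigma>" "finite A" "finite B"
  shows "\<exists>\<pi>. bij \<pi> \<and> (\<forall>x. var_sort \<Sigma> (\<pi> x) = var_sort \<Sigma> x) \<and> \<pi> ` A \<inter> B = {}"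
  using assms(2)
proof (induction A)
  case empty
  show ?case by (intro exI[of _ id]) (simp add: bij_id[unfolded id_def])
next
  case (insert a A)
  then obtain \<pi> where \<pi>: "bij \<pi>" "\<And>x. var_sort \<Sigma> (\<pi> x) = var_sort \<Sigma> x" "\<pi> ` A \<inter> B = {}"
    by auto
  \<comment> \<open>Besides avoiding \<open>B\<close>, the fresh variable must differ from the
    images of \<open>A\<close>, which the transposition would otherwise move.\<close>
  have "infinite ({y. var_sort \<Sigma> y = var_sort \<Sigma> a} - (B \<union> \<pi> ` A))"
    using assms(1,3) insert.hyps by (intro Diff_infinite_finite) (auto simp: wf_signature_def)
  from infinite_imp_nonempty[OF this] obtain y
    where y: "var_sort \<Sigma> y = var_sort \<Sigma> a" "y \<notin> B" "y \<notin> \<pi> ` A"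
    by blast
  let ?\<pi> = "transpose (\<pi> a) y \<circ> \<pi>"
  have "bij ?\<pi>" using \<pi>(1) by (intro bij_comp) auto
  moreover have "var_sort \<Sigma> (?\<pi> x) = var_sort \<Sigma> x" for x
    using \<pi>(2) y(1) by (metis comp_apply transpose_def)
  moreover have "?\<pi> x \<notin> B" if x: "x \<in> insert a A" for x
  proof (cases "x = a")
    case False
    then have "\<pi> x \<noteq> \<pi> a" "\<pi> x \<noteq> y" "\<pi> x \<notin> B"
      using x y(3) \<pi> by (auto simp: bij_def inj_def)
    then show ?thesis by simp
  qed (use y in simp)
  ultimately show ?case by blast
qed


section \<open>A total extension of the ordering\<close>

text \<open>Polish notation. The number of arguments is stored with each symbol because the type of
  terms does not fix arities, and the word has to determine the term.\<close>

fun flatten :: "('f, 'v) trm \<Rightarrow> ('v + 'f \<times> nat) list" where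
  "flatten (Var x) = [Inl x]"
| "flatten (Fun f ts) = Inr (f, length ts) # concat (map flatten ts)"

text \<open>No encoding is a proper prefix of another. The remainders \<open>xs\<close> and
  \<open>ys\<close> allow the arguments to be read off one after the other.\<close>

lemma flatten_append_inj: "flatten s @ xs = flatten t @ ys \<Longrightarrow> s = t \<and> xs = ys"
proof (induction s arbitrary: t xs ys)
  case (Var x)
  then show ?case by (cases t) auto
next
  case (Fun f ss)
  then obtain ts where t: "t = Fun f ts" and len: "length ss = length ts"
    and eq: "concat (map flatten ss) @ xs = concat (map flatten ts) @ ys"
    by (cases t) auto
  have "ss = ts \<and> xs = ys"
    using len eq Fun.IH
  proof (induction ss ts rule: list_induct2)
    case (Cons s ss t ts)
    have "flatten s @ (concat (map flatten ss) @ xs) = flatten t @ (concat (map flatten ts) @ ys)"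
      using Cons.prems(1) by simp
    then have "s = t" "concat (map flatten ss) @ xs = concat (map flatten ts) @ ys"
      using Cons.prems(2) by (meson list.set_intros(1))+
    moreover from this(2) have "ss = ts \<and> xs = ys"
      using Cons.prems(2) by (intro Cons.IH) auto
    ultimately show ?case by simp
  qed simp
  then show ?case by (simp add: t)
qed

lemma flatten_inj: "flatten s = flatten t \<Longrightarrow> s = t"
  using flatten_append_inj[of s "[]" t "[]"] by simp

text \<open>
  Variables are treated as constants: terms are compared by means of a ground instance, and terms
  with the same instance are compared as words. The extension is not stable under substitutions.
\<close>

lemma total_extension:
  assumes "wf_signature \<Sigma>" "reduction_ordering \<Sigma> gt" "total_on_ground \<Sigma> gt"
  obtains ord where
    "\<And>s t. gt s t \<Longrightarrow> ord s t"
    "wfp (\<lambda>s t. ord t s)"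
    "\<And>s t. well_sorted \<Sigma> s \<Longrightarrow> well_sorted \<Sigma> t \<Longrightarrow> s = t \<or> ord s t \<or> ord t s"
    "\<And>f xs s t ys. ord s t \<Longrightarrow> well_sorted \<Sigma> (Fun f (xs @ s # ys)) \<Longrightarrow>
       well_sorted \<Sigma> (Fun f (xs @ t # ys)) \<Longrightarrow> ord (Fun f (xs @ s # ys)) (Fun f (xs @ t # ys))"
proof -
  have "\<forall>s. \<exists>t. well_sorted \<Sigma> t \<and> ground t \<and> sort_of \<Sigma> t = s"
    using assms(1) by (simp add: wf_signature_def)
  then obtain c where c: "\<And>s. well_sorted \<Sigma> (c s) \<and> ground (c s) \<and> sort_of \<Sigma> (c s) = s"
    by metis
  \<comment> \<open>Each variable becomes a fixed ground term of its sort, so that totality on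
    ground terms applies.\<close>
  define \<tau> where "\<tau> x = c (var_sort \<Sigma> x)" for x
  have \<tau>: "substitution \<Sigma> \<tau>"
    using c by (simp add: substitution_def \<tau>_def)
  have ground: "ground (t \<cdot> \<tau>)" for t
    using c by (auto simp: ground_def vars_subst_trm \<tau>_def)
  obtain W :: "('b + 'a \<times> nat) rel" where "well_order_on UNIV W"
    using well_order_on by blast
  define R where "R = W - Id"
  have R: "wf R" "total R" "irrefl R"
    using \<open>well_order_on UNIV W\<close>
    by (auto simp: R_def well_order_on_def linear_order_on_def irrefl_def total_on_def)
  \<comment> \<open>\<open>lenlex\<close> compares lengths first and entries second, which makes it
    well-founded. Its pairs have the smaller word first, whereas \<open>ord\<close> and
    \<open>gt\<close> have the greater term first.\<close>
  define ord where "ord s t \<longleftrightarrow> gt (s \<cdot> \<tau>) (t \<cdot> \<tau>) \<or>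
    s \<cdot> \<tau> = t \<cdot> \<tau> \<and> (flatten t, flatten s) \<in> lenlex R" for s t
  note red = assms(2)[unfolded reduction_ordering_def]
  show thesis
  proof
    show "ord s t" if "gt s t" for s t
      using that red \<tau> by (auto simp: ord_def)
    have "wf {(s, t). gt t s}"
      using red by (simp add: wfp_def)
    then have "wf (inv_image ({(s, t). gt t s} <*lex*> lenlex R) (\<lambda>t. (t \<cdot> \<tau>, flatten t)))"
      using R(1) by (intro wf_inv_image wf_lex_prod wf_lenlex)
    then show "wfp (\<lambda>s t. ord t s)"
      unfolding wfp_def by (rule wf_subset) (auto simp: ord_def)
    show "s = t \<or> ord s t \<or> ord t s" if "well_sorted \<Sigma> s" "well_sorted \<Sigma> t" for s t
    proof (cases "s \<cdot> \<tau> = t \<cdot> \<tau>")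
      case True
      have "flatten s = flatten t \<or> (flatten s, flatten t) \<in> lenlex R \<or> (flatten t, flatten s) \<in> lenlex R"
        using total_lenlex[OF R(2)] by (auto simp: total_on_def)
      then show ?thesis using True flatten_inj by (auto simp: ord_def)
    next
      case False
      then show ?thesis
        using assms(3) that(1,2)[THEN well_sorted_subst[OF \<tau>]] ground[of s] ground[of t]
        unfolding ord_def total_on_ground_def by blast
    qed
    show "ord (Fun f (xs @ s # ys)) (Fun f (xs @ t # ys))"
      if st: "ord s t" and ws: "well_sorted \<Sigma> (Fun f (xs @ s # ys))"
        "well_sorted \<Sigma> (Fun f (xs @ t # ys))" for f xs s t ys
      using st[unfolded ord_def]
    proof
      assume gt: "gt (s \<cdot> \<tau>) (t \<cdot> \<tau>)"
      let ?u = "Fun f (xs @ s # ys) \<cdot> \<tau>" and ?p = "[Suc (length xs)]"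
      have "put_trm ?u ?p (s \<cdot> \<tau>) = ?u" "put_trm ?u ?p (t \<cdot> \<tau>) = Fun f (xs @ t # ys) \<cdot> \<tau>"
        "trm_at ?u ?p \<noteq> None"
        by (auto simp: list_update_append nth_append)
      moreover have "well_sorted \<Sigma> ?u" "well_sorted \<Sigma> (Fun f (xs @ t # ys) \<cdot> \<tau>)"
        using ws \<tau> by (blast intro: well_sorted_subst)+
      ultimately have "gt ?u (Fun f (xs @ t # ys) \<cdot> \<tau>)"
        using red gt by metis
      then show ?thesis by (simp add: ord_def)
    next
      assume "s \<cdot> \<tau> = t \<cdot> \<tau> \<and> (flatten t, flatten s) \<in> lenlex R"
      \<comment> \<open>The words differ only in the block of the changed argument, since the arity
        at the head stays the same; \<open>lenlex\<close> respects common prefixes and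
        suffixes.\<close>
      then show ?thesis
        using R(3) by (auto simp: ord_def Cons_lenlex_iff lenlex_append1)
    qed
  qed
qed


section \<open>Positions\<close>

lemma left_of_Nil [simp]: "\<not> left_of [] q" "\<not> left_of p []"
  by (auto simp: left_of_def)

lemma left_of_Cons [simp]:
  "left_of (i # p) (j # q) \<longleftrightarrow> 0 < i \<and> i < j \<or> i = j \<and> left_of p q"
proof
  assume "left_of (i # p) (j # q)"
  then obtain a b r p' q' where ab: "0 < a" "a < b" and eq: "i # p = r @ a # p'" "j # q = r @ b # q'"
    unfolding left_of_def by blast
  show "0 < i \<and> i < j \<or> i = j \<and> left_of p q"
    using ab eq by (cases r) (auto simp: left_of_def)
next
  assume "0 < i \<and> i < j \<or> i = j \<and> left_of p q"
  then show "left_of (i # p) (j # q)"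
  proof
    assume "0 < i \<and> i < j"
    then show ?thesis
      unfolding left_of_def by (metis append_Nil)
  next
    assume "i = j \<and> left_of p q"
    then show ?thesis
      unfolding left_of_def by (metis append_Cons)
  qed
qed

lemma left_of_asym: "left_of p q \<Longrightarrow> \<not> left_of q p"
proof (induction p arbitrary: q)
  case (Cons i p)
  then show ?case by (cases q) auto
qed simp

section \<open>Replacement at parallel positions\<close>

abbreviation parallel :: "pos \<Rightarrow> pos \<Rightarrow> bool" where
  "parallel p q \<equiv> left_of p q \<or> left_of q p"

lemma trm_at_put_parallel: "parallel p q \<Longrightarrow> trm_at (put_trm t p u) q = trm_at t q"
proof (induction t p u arbitrary: q rule: put_trm.induct)
  case (3 f ts i p u)
  then show ?case by (cases q) (auto simp: nth_list_update)
qed auto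

lemma put_put_trm_parallel:
  "parallel p q \<Longrightarrow> put_trm (put_trm t p u) q v = put_trm (put_trm t q v) p u"
proof (induction t p u arbitrary: q rule: put_trm.induct)
  case (3 f ts i p u)
  then show ?case by (cases q) (auto simp: nth_list_update list_update_swap)
next
  case (2 x i p u)
  then show ?case by (cases q) auto
qed auto

lemma lit_at_put_parallel: "parallel p q \<Longrightarrow> lit_at (put_lit L p u) q = lit_at L q"
  by (cases L; cases p; cases q) (auto simp: trm_at_put_parallel)

lemma put_put_lit_parallel:
  "parallel p q \<Longrightarrow> put_lit (put_lit L p u) q v = put_lit (put_lit L q v) p u"
  by (cases L; cases p; cases q) (auto simp: put_put_trm_parallel)

lemma clause_at_put_parallel: "parallel p q \<Longrightarrow> clause_at (put_clause C p u) q = clause_at C q"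
  by (cases p; cases q) (auto simp: lit_at_put_parallel nth_list_update)

lemma put_put_clause_parallel:
  "parallel p q \<Longrightarrow> put_clause (put_clause C p u) q v = put_clause (put_clause C q v) p u"
  by (cases p; cases q) (auto simp: put_put_lit_parallel nth_list_update list_update_swap)

section \<open>Replacement, substitutions and sorts\<close>

lemma put_trm_subst:
  "trm_at t p = Some u \<Longrightarrow> put_trm t p s \<cdot> \<sigma> = put_trm (t \<cdot> \<sigma>) p (s \<cdot> \<sigma>)"
  by (induction t p s rule: put_trm.induct) (auto simp: map_update split: if_splits)

lemma vars_trm_at: "trm_at t p = Some u \<Longrightarrow> vars_trm u \<subseteq> vars_trm t"
proof (induction t p rule: trm_at.induct)
  case (3 f ts i p)
  then have "vars_trm u \<subseteq> vars_trm (ts ! (i - 1))" "ts ! (i - 1) \<in> set ts"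
    by (auto split: if_splits)
  then show ?case by auto
qed auto

lemma well_sorted_trm_at: "trm_at t p = Some u \<Longrightarrow> well_sorted \<Sigma> t \<Longrightarrow> well_sorted \<Sigma> u"
  by (induction t p rule: trm_at.induct) (auto split: if_splits)

lemma put_trm_well_sorted:
  "trm_at t p = Some u \<Longrightarrow> well_sorted \<Sigma> t \<Longrightarrow> well_sorted \<Sigma> s \<Longrightarrow> sort_of \<Sigma> s = sort_of \<Sigma> u \<Longrightarrow>
   well_sorted \<Sigma> (put_trm t p s) \<and> sort_of \<Sigma> (put_trm t p s) = sort_of \<Sigma> t"
proof (induction t p s rule: put_trm.induct)
  case (3 f ts i p s)
  then have i: "1 \<le> i" "i \<le> length ts" and at: "trm_at (ts ! (i - 1)) p = Some u"
    by (auto split: if_splits)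
  have IH: "well_sorted \<Sigma> (put_trm (ts ! (i - 1)) p s)"
    "sort_of \<Sigma> (put_trm (ts ! (i - 1)) p s) = sort_of \<Sigma> (ts ! (i - 1))"
    using 3 i at by auto
  have "map (sort_of \<Sigma>) (ts[i - 1 := put_trm (ts ! (i - 1)) p s]) = map (sort_of \<Sigma>) ts"
    using i IH(2) by (metis list_update_id map_update)
  moreover have "\<forall>t\<in>set (ts[i - 1 := put_trm (ts ! (i - 1)) p s]). well_sorted \<Sigma> t"
    using IH(1) 3(3) by (auto dest!: set_update_subset_insert[THEN subsetD])
  ultimately show ?case using i 3(3) by simp
qed auto

lemma clause_at_unit_cases:
  assumes "clause_at [Lit b u v] q = Some s"
  obtains p where "q = 1 # 1 # p" "trm_at u p = Some s" | p where "q = 1 # 2 # p" "trm_at v p = Some s"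
  using assms that by (cases q; cases "tl q") (auto split: if_splits)


section \<open>Rewriting derivable clauses\<close>

text \<open>
  The position restrictions do not lose anything: a rewrite that is out of order is moved in front
  of the rewrites to its right, which are parallel to it.
\<close>

lemma ReC_rewrite_left:
  assumes "ReC \<Sigma> gt sel N a p C" and "left_of q p"
    and "ReC \<Sigma> gt sel N Plain p' E" "is_equation E l r" "substitution \<Sigma> \<theta>"
    and "clause_at C q = Some (l \<cdot> \<theta>)"
    and "a = Plain \<Longrightarrow> \<not> geq gt (r \<cdot> \<theta>) (l \<cdot> \<theta>)" "a = Upward \<Longrightarrow> \<not> geq gt (l \<cdot> \<theta>) (r \<cdot> \<theta>)"
  shows "ReC \<Sigma> gt sel N a p (put_clause C q (r \<cdot> \<theta>))"
  using assms(1,2,6-)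
\<comment> \<open>Inputs and the results of \<open>Sup\<close>, \<open>EqRes\<close> and
  \<open>EqFac\<close> carry the position \<open>[]\<close>, which has nothing to its left; only the
  two rewrite rules remain.\<close>
proof (induction rule: ReC.induct)
  case (RwDown p C p'' E' l' r' \<theta>' q')
  have at: "clause_at C q = Some (l \<cdot> \<theta>)"
    using RwDown.prems by (simp add: clause_at_put_parallel)
  have at': "clause_at (put_clause C q (r \<cdot> \<theta>)) q' = Some (l' \<cdot> \<theta>')"
    using RwDown by (simp add: clause_at_put_parallel)
  have down: "\<not> geq gt (r \<cdot> \<theta>) (l \<cdot> \<theta>)"
    using RwDown.prems by simp
  \<comment> \<open>The rewrite at \<open>q\<close> is put before the last one, at
    \<open>q'\<close>: by the induction hypothesis if \<open>q\<close> is to the left of the earlier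
    position \<open>p\<close> as well, and directly otherwise. In the second case the clause carries
    \<open>q\<close>, and \<open>q'\<close> is not to the left of \<open>q\<close>.\<close>
  obtain p0 where "ReC \<Sigma> gt sel N Plain p0 (put_clause C q (r \<cdot> \<theta>))" "\<not> left_of q' p0"
  proof (cases "left_of q p")
    case True
    then show ?thesis using that RwDown.IH(1) at down RwDown.hyps by blast
  next
    case False
    then show ?thesis
      using that ReC.RwDown[OF RwDown.hyps(1) assms(3-5) at down] RwDown.prems left_of_asym by blast
  qed
  then have "ReC \<Sigma> gt sel N Plain q' (put_clause (put_clause C q (r \<cdot> \<theta>)) q' (r' \<cdot> \<theta>'))"
    using RwDown.hyps at' by (intro ReC.RwDown) auto
  then show ?case
    using RwDown.prems put_put_clause_parallel by metis
next
  case (RwUp a p C p'' E' l' r' \<theta>' q')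
  have at: "clause_at C q = Some (l \<cdot> \<theta>)"
    using RwUp.prems by (simp add: clause_at_put_parallel)
  have at': "clause_at (put_clause C q (r \<cdot> \<theta>)) q' = Some (l' \<cdot> \<theta>')"
    using RwUp by (simp add: clause_at_put_parallel)
  have up: "\<not> geq gt (l \<cdot> \<theta>) (r \<cdot> \<theta>)"
    using RwUp.prems by simp
  \<comment> \<open>A \<open>Plain\<close> premise permits an upward rewrite anywhere. The induction
    hypothesis is reserved for \<open>Upward\<close>, since for \<open>Plain\<close> it asks for a
    downward rewrite.\<close>
  obtain p0 where "ReC \<Sigma> gt sel N Upward p0 (put_clause C q (r \<cdot> \<theta>))" "\<not> left_of q' p0"
  proof (cases "a = Upward \<and> left_of q p")
    case True
    then show ?thesis using that RwUp.IH(1) at up RwUp.hyps by blast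
  next
    case False
    then have "a = Plain \<or> \<not> left_of q p"
      using annot.exhaust by blast
    then show ?thesis
      using that ReC.RwUp[OF RwUp.hyps(1) assms(3-5) at up] RwUp.prems left_of_asym by blast
  qed
  then have "ReC \<Sigma> gt sel N Upward q' (put_clause (put_clause C q (r \<cdot> \<theta>)) q' (r' \<cdot> \<theta>'))"
    using ReC.RwUp[OF _ RwUp.hyps(2-4) at' RwUp.hyps(6)] by blast
  then show ?case
    using RwUp.prems put_put_clause_parallel by metis
qed simp_all

lemma ReC_rewrite_down:
  assumes "ReC \<Sigma> gt sel N Plain p C"
    and "ReC \<Sigma> gt sel N Plain p' E" "is_equation E l r" "substitution \<Sigma> \<theta>"
    and "clause_at C q = Some (l \<cdot> \<theta>)" "\<not> geq gt (r \<cdot> \<theta>) (l \<cdot> \<theta>)"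
  shows "\<exists>p. ReC \<Sigma> gt sel N Plain p (put_clause C q (r \<cdot> \<theta>))"
  using ReC_rewrite_left[OF assms(1) _ assms(2-5)] ReC.RwDown[OF assms] assms(6) by blast

lemma ReC_rewrite_up:
  assumes "derivable \<Sigma> gt sel N C"
    and "ReC \<Sigma> gt sel N Plain p' E" "is_equation E l r" "substitution \<Sigma> \<theta>"
    and "clause_at C q = Some (l \<cdot> \<theta>)" "\<not> geq gt (l \<cdot> \<theta>) (r \<cdot> \<theta>)"
  shows "derivable \<Sigma> gt sel N (put_clause C q (r \<cdot> \<theta>))"
proof -
  obtain a p where C: "ReC \<Sigma> gt sel N a p C"
    using assms(1) by (auto simp: derivable_def)
  show ?thesis
  proof (cases "a = Upward \<and> left_of q p")
    case True
    then show ?thesis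
      using ReC_rewrite_left[OF C _ assms(2-5)] assms(6) unfolding derivable_def by blast
  next
    case False
    then have "a = Plain \<or> \<not> left_of q p"
      using annot.exhaust by blast
    then show ?thesis
      using ReC.RwUp[OF C assms(2-6)] unfolding derivable_def by blast
  qed
qed

lemma ReC_mono:
  assumes "ReC \<Sigma> gt sel N a p C" and "N \<subseteq> M"
  shows "ReC \<Sigma> gt sel M a p C"
  using assms(1)
proof (induction rule: ReC.induct)
  case (Input C)
  then show ?case using assms(2) by (auto intro: ReC.Input)
next
  case Sup
  then show ?case by (intro ReC.Sup)
next
  case EqRes
  then show ?case by (intro ReC.EqRes)
next
  case EqFac
  then show ?case by (intro ReC.EqFac)
next
  case RwDown
  then show ?case by (intro ReC.RwDown)
next
  case RwUp
  then show ?case by (intro ReC.RwUp)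
qed

lemma derivable_mono: "derivable \<Sigma> gt sel N C \<Longrightarrow> N \<subseteq> M \<Longrightarrow> derivable \<Sigma> gt sel M C"
  unfolding derivable_def using ReC_mono by blast

section \<open>Unit equations\<close>

lemma same_lit_Lit:
  "same_lit (Lit b u v) (Lit c s t) \<longleftrightarrow> b = c \<and> (u = s \<and> v = t \<or> u = t \<and> v = s)"
  by (auto simp: same_lit_def)

lemma is_equation_iff: "is_equation E l r \<longleftrightarrow> E = [Lit True l r] \<or> E = [Lit True r l]"
  by (auto simp: is_equation_def same_lit_def)

definition unit_equation :: "('f, 'v, 's) signature \<Rightarrow> ('f, 'v) clause \<Rightarrow> bool" where
  "unit_equation \<Sigma> C \<longleftrightarrow> (\<exists>s t. C = [Lit True s t] \<and>
     well_sorted \<Sigma> s \<and> well_sorted \<Sigma> t \<and> sort_of \<Sigma> s = sort_of \<Sigma> t)"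

lemma unit_equation_put:
  assumes "unit_equation \<Sigma> C" "unit_equation \<Sigma> E" "is_equation E l r" "substitution \<Sigma> \<theta>"
    "clause_at C q = Some (l \<cdot> \<theta>)"
  shows "unit_equation \<Sigma> (put_clause C q (r \<cdot> \<theta>))"
proof -
  obtain u v where C: "C = [Lit True u v]" "well_sorted \<Sigma> u" "well_sorted \<Sigma> v"
    "sort_of \<Sigma> u = sort_of \<Sigma> v"
    using assms(1) by (auto simp: unit_equation_def)
  have lr: "well_sorted \<Sigma> (r \<cdot> \<theta>)" "sort_of \<Sigma> (r \<cdot> \<theta>) = sort_of \<Sigma> (l \<cdot> \<theta>)"
    using assms by (auto simp: unit_equation_def is_equation_iff)
  show ?thesis
    using assms(5)[unfolded C(1)]
  proof (cases rule: clause_at_unit_cases)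
    case (1 p)
    then show ?thesis
      using C lr put_trm_well_sorted[OF 1(2) C(2) lr] by (auto simp: unit_equation_def)
  next
    case (2 p)
    then show ?thesis
      using C lr put_trm_well_sorted[OF 2(2) C(3) lr] by (auto simp: unit_equation_def)
  qed
qed

text \<open>\<open>EqRes\<close> needs a negative literal and \<open>EqFac\<close> two literals, so
  neither applies. \<open>Sup\<close> leaves no side literals, and its replacement is well sorted
  because unified terms have the same sort.\<close>

lemma ReC_unit_equation:
  assumes "\<And>C. C \<in> N \<Longrightarrow> unit_equation \<Sigma> C" and "ReC \<Sigma> gt sel N a p C"
  shows "unit_equation \<Sigma> C"
  using assms(2)
proof (induction rule: ReC.induct)
  case (Sup p P q Q0 i b s t j \<rho> Q l r k u \<theta>)
  obtain s0 t0 where P: "P = [Lit True s0 t0]" "well_sorted \<Sigma> s0" "well_sorted \<Sigma> t0"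
    "sort_of \<Sigma> s0 = sort_of \<Sigma> t0"
    using Sup.IH by (auto simp: unit_equation_def)
  obtain l0 r0 where Q0: "Q0 = [Lit True l0 r0]" "well_sorted \<Sigma> l0" "well_sorted \<Sigma> r0"
    "sort_of \<Sigma> l0 = sort_of \<Sigma> r0"
    using Sup.IH by (auto simp: unit_equation_def)
  have \<rho>: "substitution \<Sigma> \<rho>" and \<theta>: "substitution \<Sigma> \<theta>" "l \<cdot> \<theta> = u \<cdot> \<theta>"
    using Sup.hyps by (auto simp: renaming_def is_mgu_def)
  have ij: "i = 0" "j = 0"
    using Sup.hyps(3,6) P Q0 by auto
  have st: "b" "well_sorted \<Sigma> s" "well_sorted \<Sigma> t" "sort_of \<Sigma> s = sort_of \<Sigma> t"
    using Sup.hyps(5) P ij by (auto simp: same_lit_Lit)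
  have lr: "well_sorted \<Sigma> l" "well_sorted \<Sigma> r" "sort_of \<Sigma> l = sort_of \<Sigma> r"
    using Sup.hyps(9,11) Q0 ij \<rho> by (auto simp: same_lit_Lit subst_clause_def)
  have "sort_of \<Sigma> r = sort_of \<Sigma> u"
    using \<theta> lr(3) sort_of_subst by metis
  then have "well_sorted \<Sigma> (put_trm s k r)" "sort_of \<Sigma> (put_trm s k r) = sort_of \<Sigma> s"
    using put_trm_well_sorted[OF Sup.hyps(12) st(2) lr(2)] by auto
  moreover have "nths P (- {i}) = []" "nths Q (- {j}) = []"
    using ij P Q0 Sup.hyps(9) by (auto simp: subst_clause_def)
  ultimately show ?case
    using st \<theta>(1) by (simp add: subst_clause_def unit_equation_def)
next
  case (EqRes p P i s t \<theta>)
  then show ?case by (auto simp: unit_equation_def same_lit_Lit)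
next
  case (EqFac p P i j s t u w \<theta>)
  then show ?case by (auto simp: unit_equation_def)
qed (use assms(1) unit_equation_put in blast)+


section \<open>Ordered rewriting\<close>

text \<open>Newman's lemma, by well-founded induction on the top of the peak: the first steps are
  joined at \<open>d\<close>, the peak at \<open>b'\<close> then gives \<open>e\<close>, and the
  peak at \<open>c'\<close> gives \<open>f\<close>.\<close>

lemma newman:
  assumes "wfp (\<lambda>s t. R t s)"
    and peak: "\<And>a b c. R a b \<Longrightarrow> R a c \<Longrightarrow> \<exists>d. R\<^sup>*\<^sup>* b d \<and> R\<^sup>*\<^sup>* c d"
  shows "confluentp R"
proof (rule confluentpI)
  show "\<exists>d. R\<^sup>*\<^sup>* b d \<and> R\<^sup>*\<^sup>* c d" if "R\<^sup>*\<^sup>* a b" "R\<^sup>*\<^sup>* a c" for a b c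
    using assms(1) that
  proof (induction a arbitrary: b c rule: wfp_induct_rule)
    case (less a)
    show ?case
    proof (cases "a = b \<or> a = c")
      case True
      then show ?thesis using less.prems by blast
    next
      case False
      obtain b' where b': "R a b'" "R\<^sup>*\<^sup>* b' b"
        using less.prems(1) False by (auto elim: converse_rtranclpE)
      obtain c' where c': "R a c'" "R\<^sup>*\<^sup>* c' c"
        using less.prems(2) False by (auto elim: converse_rtranclpE)
      obtain d where d: "R\<^sup>*\<^sup>* b' d" "R\<^sup>*\<^sup>* c' d"
        using peak[OF b'(1) c'(1)] by blast
      obtain e where e: "R\<^sup>*\<^sup>* b e" "R\<^sup>*\<^sup>* d e"
        using less.IH[OF b'(1) b'(2) d(1)] by blast
      have "R\<^sup>*\<^sup>* c' e"
        using d(2) e(2) by (rule rtranclp_trans)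
      then obtain f where "R\<^sup>*\<^sup>* e f" "R\<^sup>*\<^sup>* c f"
        using less.IH[OF c'(1) _ c'(2)] by blast
      then show ?thesis
        using e(1) by (meson rtranclp_trans)
    qed
  qed
qed

lemma well_sorted_replace_arg:
  assumes "well_sorted \<Sigma> (Fun f (xs @ s # ys))" "well_sorted \<Sigma> t" "sort_of \<Sigma> s = sort_of \<Sigma> t"
  shows "well_sorted \<Sigma> (Fun f (xs @ t # ys))"
  using assms by auto

text \<open>\<open>ord\<close> stands for the total extension of \<open>gt\<close>. As it need not
  be stable under substitutions, equations are oriented instance by instance.\<close>

locale equational_ReC =
  fixes \<Sigma> :: "('f, 'v, 's) signature"
    and gt ord :: "('f, 'v) trm \<Rightarrow> ('f, 'v) trm \<Rightarrow> bool"
    and sel :: "('f, 'v) clause \<Rightarrow> nat set"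
    and N :: "('f, 'v) clause set"
  assumes signature: "wf_signature \<Sigma>"
    and reduction: "reduction_ordering \<Sigma> gt"
    and selection: "selection_function \<Sigma> gt sel"
    and input: "\<And>C. C \<in> N \<Longrightarrow> unit_equation \<Sigma> C"
    and ord_ext: "\<And>s t. gt s t \<Longrightarrow> ord s t"
    and ord_wf: "wfp (\<lambda>s t. ord t s)"
    and ord_total: "\<And>s t. well_sorted \<Sigma> s \<Longrightarrow> well_sorted \<Sigma> t \<Longrightarrow> s = t \<or> ord s t \<or> ord t s"
    and ord_arg: "\<And>f xs s t ys. ord s t \<Longrightarrow> well_sorted \<Sigma> (Fun f (xs @ s # ys)) \<Longrightarrow>
       well_sorted \<Sigma> (Fun f (xs @ t # ys)) \<Longrightarrow> ord (Fun f (xs @ s # ys)) (Fun f (xs @ t # ys))"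
begin

text \<open>Exactly the equations that may serve for rewriting; an equation annotated
  \<open>Upward\<close> may not.\<close>

definition plain_eq :: "('f, 'v) trm \<Rightarrow> ('f, 'v) trm \<Rightarrow> bool" where
  "plain_eq s t \<longleftrightarrow> (\<exists>p E. ReC \<Sigma> gt sel N Plain p E \<and> is_equation E s t)"

text \<open>Contexts are built one argument at a time, which suits induction over terms;
  \<open>step_position\<close> recovers the position that the calculus asks for.\<close>

inductive step :: "('f, 'v) trm \<Rightarrow> ('f, 'v) trm \<Rightarrow> bool" where
  root: "plain_eq l r \<Longrightarrow> substitution \<Sigma> \<theta> \<Longrightarrow> ord (l \<cdot> \<theta>) (r \<cdot> \<theta>) \<Longrightarrow> step (l \<cdot> \<theta>) (r \<cdot> \<theta>)"
| arg: "step s t \<Longrightarrow> well_sorted \<Sigma> (Fun f (xs @ s # ys)) \<Longrightarrow>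
    step (Fun f (xs @ s # ys)) (Fun f (xs @ t # ys))"

lemma unit: "ReC \<Sigma> gt sel N a p C \<Longrightarrow> unit_equation \<Sigma> C"
  using input by (rule ReC_unit_equation)

lemma ord_asym: "ord s t \<Longrightarrow> \<not> ord t s"
  using ord_wf wfp_imp_asymp[OF ord_wf] by (auto dest: asympD)

lemma ord_imp_not_geq: "ord s t \<Longrightarrow> \<not> geq gt t s"
  using ord_asym ord_ext by (auto simp: geq_def)

text \<open>Superposition imposes its ordering conditions on the mgu instance, whereas
  \<open>ord\<close> compares a further instance. Stability of \<open>gt\<close> carries a violation
  down to that instance, where it contradicts \<open>ord\<close>.\<close>

lemma ord_imp_not_geq_general:
  assumes "ord (s \<cdot> \<sigma>) (t \<cdot> \<sigma>)" "substitution \<Sigma> \<sigma>"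
  shows "\<not> geq gt t s"
  using assms reduction ord_imp_not_geq[OF assms(1)]
  unfolding geq_def reduction_ordering_def by metis

lemma plain_eq_sym: "plain_eq s t \<Longrightarrow> plain_eq t s"
  by (auto simp: plain_eq_def is_equation_iff)

lemma plain_eq_well_sorted:
  assumes "plain_eq s t"
  shows "well_sorted \<Sigma> s \<and> well_sorted \<Sigma> t \<and> sort_of \<Sigma> s = sort_of \<Sigma> t"
  using assms unit by (fastforce simp: plain_eq_def unit_equation_def is_equation_iff)

text \<open>Here totality of \<open>ord\<close> enters: no instance of a derivable equation is left
  unoriented.\<close>

lemma plain_eq_instance:
  assumes "plain_eq s t" "substitution \<Sigma> \<theta>"
  shows "s \<cdot> \<theta> = t \<cdot> \<theta> \<or> step (s \<cdot> \<theta>) (t \<cdot> \<theta>) \<or> step (t \<cdot> \<theta>) (s \<cdot> \<theta>)"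
  using ord_total[of "s \<cdot> \<theta>" "t \<cdot> \<theta>"] plain_eq_well_sorted[OF assms(1)] assms
  by (auto intro: root plain_eq_sym)

lemma step_well_sorted:
  "step s t \<Longrightarrow> well_sorted \<Sigma> s \<and> well_sorted \<Sigma> t \<and> sort_of \<Sigma> s = sort_of \<Sigma> t"
proof (induction rule: step.induct)
  case (root l r \<theta>)
  then show ?case using plain_eq_well_sorted by auto
next
  case (arg s t f xs ys)
  then show ?case using well_sorted_replace_arg by auto
qed

lemma step_ord: "step s t \<Longrightarrow> ord s t"
proof (induction rule: step.induct)
  case (arg s t f xs ys)
  then show ?case
    using step_well_sorted[OF step.arg] by (intro ord_arg) auto
qed

lemma step_wf: "wfp (\<lambda>s t. step t s)"
  using ord_wf by (rule wfp_subset) (auto intro: step_ord)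

lemma steps_well_sorted:
  "step\<^sup>*\<^sup>* s t \<Longrightarrow> well_sorted \<Sigma> s \<Longrightarrow> well_sorted \<Sigma> t \<and> sort_of \<Sigma> s = sort_of \<Sigma> t"
  by (induction rule: rtranclp_induct) (auto dest: step_well_sorted)

text \<open>The replacement is also given in reverse, because upward rewriting undoes the step at
  the same position.\<close>

lemma step_position:
  "step s t \<Longrightarrow> \<exists>p l r \<theta>. plain_eq l r \<and> substitution \<Sigma> \<theta> \<and> ord (l \<cdot> \<theta>) (r \<cdot> \<theta>) \<and>
     trm_at s p = Some (l \<cdot> \<theta>) \<and> trm_at t p = Some (r \<cdot> \<theta>) \<and>
     t = put_trm s p (r \<cdot> \<theta>) \<and> s = put_trm t p (l \<cdot> \<theta>)"
proof (induction rule: step.induct)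
  case (root l r \<theta>)
  then show ?case by (intro exI[of _ "[]"] exI[of _ l] exI[of _ r] exI[of _ \<theta>]) auto
next
  case (arg s t f xs ys)
  then obtain p l r \<theta> where "plain_eq l r" "substitution \<Sigma> \<theta>" "ord (l \<cdot> \<theta>) (r \<cdot> \<theta>)"
     "trm_at s p = Some (l \<cdot> \<theta>)" "trm_at t p = Some (r \<cdot> \<theta>)"
     "put_trm s p (r \<cdot> \<theta>) = t" "put_trm t p (l \<cdot> \<theta>) = s"
    by metis
  then show ?case
    by (intro exI[of _ "Suc (length xs) # p"] exI[of _ l] exI[of _ r] exI[of _ \<theta>])
      (auto simp: nth_append list_update_append)
qed

lemma equivclp_step_arg:
  assumes "equivclp step s t" "well_sorted \<Sigma> (Fun f (xs @ s # ys))"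
  shows "equivclp step (Fun f (xs @ s # ys)) (Fun f (xs @ t # ys)) \<and>
    well_sorted \<Sigma> (Fun f (xs @ t # ys)) \<and> sort_of \<Sigma> s = sort_of \<Sigma> t"
  using assms(1)
proof (induction rule: equivclp_induct)
  case base
  then show ?case using assms(2) by simp
next
  case (step t u)
  then have ws: "well_sorted \<Sigma> (Fun f (xs @ u # ys))" "sort_of \<Sigma> s = sort_of \<Sigma> u"
    using step_well_sorted well_sorted_replace_arg[of \<Sigma> f xs t ys u] by auto
  have "step (Fun f (xs @ t # ys)) (Fun f (xs @ u # ys)) \<or>
        step (Fun f (xs @ u # ys)) (Fun f (xs @ t # ys))"
    using step ws by (blast intro: step.arg)
  then show ?case
    using step.IH ws by (meson equivclp_into_equivclp)
qed

lemma steps_arg: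
  assumes "step\<^sup>*\<^sup>* s t" "well_sorted \<Sigma> (Fun f (xs @ s # ys))"
  shows "step\<^sup>*\<^sup>* (Fun f (xs @ s # ys)) (Fun f (xs @ t # ys))"
  using assms(1)
proof (induction rule: rtranclp_induct)
  case (step t u)
  have "well_sorted \<Sigma> (Fun f (xs @ t # ys))"
    using steps_well_sorted[OF step.hyps(1)] assms(2) by (intro well_sorted_replace_arg[OF assms(2)]) auto
  then show ?case using step by (meson step.arg rtranclp.rtrancl_into_rtrancl)
qed simp

lemma steps_args:
  assumes "list_all2 step\<^sup>*\<^sup>* ss ts" "well_sorted \<Sigma> (Fun f (xs @ ss))"
  shows "step\<^sup>*\<^sup>* (Fun f (xs @ ss)) (Fun f (xs @ ts))"
  using assms
proof (induction arbitrary: xs rule: list_all2_induct)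
  case (Cons s ss t ts)
  have st: "step\<^sup>*\<^sup>* (Fun f (xs @ s # ss)) (Fun f (xs @ t # ss))"
    using Cons by (intro steps_arg) auto
  then have "well_sorted \<Sigma> (Fun f ((xs @ [t]) @ ss))"
    using steps_well_sorted[OF st Cons.prems] by simp
  from Cons.IH[OF this] st show ?case by (auto intro: rtranclp_trans)
qed simp

text \<open>For overlaps at or below variables: steps in the value of a variable are repeated at all
  its occurrences.\<close>

lemma steps_subst:
  assumes "\<And>x. step\<^sup>*\<^sup>* (\<sigma> x) (\<tau> x)" "substitution \<Sigma> \<sigma>" "well_sorted \<Sigma> t"
  shows "step\<^sup>*\<^sup>* (t \<cdot> \<sigma>) (t \<cdot> \<tau>)"
  using assms(3)
proof (induction t)
  case (Fun f ts)
  have "list_all2 step\<^sup>*\<^sup>* (map (\<lambda>t. t \<cdot> \<sigma>) ts) (map (\<lambda>t. t \<cdot> \<tau>) ts)"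
    using Fun by (auto simp: list_all2_conv_all_nth)
  moreover have "well_sorted \<Sigma> (Fun f ([] @ map (\<lambda>t. t \<cdot> \<sigma>) ts))"
    using well_sorted_subst[OF assms(2) Fun.prems] by simp
  ultimately show ?case
    using steps_args[of _ _ f "[]"] by fastforce
qed (use assms in simp)

text \<open>The orientation does not matter: at the root the instance is trivial or a step in one
  direction, and conversions pass through arguments.\<close>

lemma equivclp_step_put:
  assumes "plain_eq l r" "substitution \<Sigma> \<theta>" "trm_at s p = Some (l \<cdot> \<theta>)" "well_sorted \<Sigma> s"
  shows "equivclp step s (put_trm s p (r \<cdot> \<theta>))"
  using assms(3,4)
proof (induction s p rule: trm_at.induct)
  case (1 t)
  then show ?case
    using plain_eq_instance[OF assms(1,2)] by auto
next
  case (3 f ts i p)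
  then have i: "1 \<le> i" "i \<le> length ts" by (auto split: if_splits)
  define xs s ys where "xs = take (i - 1) ts" and "s = ts ! (i - 1)" and "ys = drop i ts"
  have ts: "ts = xs @ s # ys"
    using i id_take_nth_drop[of "i - 1" ts] by (simp add: xs_def s_def ys_def)
  have len: "length xs = i - 1" using i by (simp add: xs_def)
  have "equivclp step s (put_trm s p (r \<cdot> \<theta>))"
    using 3 i by (auto simp: s_def)
  then have "equivclp step (Fun f ts) (Fun f (xs @ put_trm s p (r \<cdot> \<theta>) # ys))"
    using equivclp_step_arg 3(3) unfolding ts by blast
  moreover have "put_trm (Fun f ts) (i # p) (r \<cdot> \<theta>) = Fun f (xs @ put_trm s p (r \<cdot> \<theta>) # ys)"
    using i len by (simp add: ts list_update_append nth_append)
  ultimately show ?case by simp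
qed simp


subsection \<open>Local confluence\<close>

text \<open>The multiset extension of a well-founded relation is irreflexive, so the only literal is
  maximal; as it is positive, the selection condition forces its selection.\<close>

lemma selected_unit: "unit_equation \<Sigma> C \<Longrightarrow> 0 \<in> sel C"
proof -
  assume C: "unit_equation \<Sigma> C"
  then obtain s t where Ceq: "C = [Lit True s t]"
    by (auto simp: unit_equation_def)
  have ws: "well_sorted_clause \<Sigma> C"
    using C by (auto simp: unit_equation_def well_sorted_clause_def)
  have "wfp (multp (\<lambda>s t. gt t s))"
    using reduction by (intro wfp_multp) (simp add: reduction_ordering_def)
  then have "\<not> lit_gt gt L L" for L
    unfolding lit_gt_def by (meson asympD wfp_imp_asymp)
  then have "0 \<in> maximal_lits gt C"
    by (auto simp: maximal_lits_def Ceq)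
  moreover have "sel C \<subseteq> {..<length C}" "(\<exists>i\<in>sel C. \<not> is_pos (C ! i)) \<or> maximal_lits gt C \<subseteq> sel C"
    using selection ws Ceq unfolding selection_function_def by blast+
  ultimately show "0 \<in> sel C"
    by (auto simp: Ceq)
qed

text \<open>The critical pair is an instance of the conclusion of a superposition inference.\<close>

lemma critical_overlap:
  assumes st: "plain_eq s t" "substitution \<Sigma> \<sigma>" "ord (s \<cdot> \<sigma>) (t \<cdot> \<sigma>)"
    and lr: "plain_eq l r" "substitution \<Sigma> \<theta>" "ord (l \<cdot> \<theta>) (r \<cdot> \<theta>)"
    and u: "trm_at s k = Some u" "\<nexists>x. u = Var x" "u \<cdot> \<sigma> = l \<cdot> \<theta>"
  shows "\<exists>s' t' \<delta>. plain_eq s' t' \<and> substitution \<Sigma> \<delta> \<and>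
    s' \<cdot> \<delta> = put_trm (s \<cdot> \<sigma>) k (r \<cdot> \<theta>) \<and> t' \<cdot> \<delta> = t \<cdot> \<sigma>"
proof -
  obtain p P where P: "ReC \<Sigma> gt sel N Plain p P" "is_equation P s t"
    using st(1) by (auto simp: plain_eq_def)
  obtain q Q0 where Q0: "ReC \<Sigma> gt sel N Plain q Q0" "is_equation Q0 l r"
    using lr(1) by (auto simp: plain_eq_def)
  obtain \<pi> where \<pi>: "bij \<pi>" "\<And>x. var_sort \<Sigma> (\<pi> x) = var_sort \<Sigma> x"
    "\<pi> ` (vars_trm l \<union> vars_trm r) \<inter> (vars_trm s \<union> vars_trm t) = {}"
    using renaming_apart_exists[OF signature, of "vars_trm l \<union> vars_trm r" "vars_trm s \<union> vars_trm t"]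
    by auto
  define \<rho> where "\<rho> x = (Var (\<pi> x) :: ('f, 'v) trm)" for x
  have \<rho>: "renaming \<Sigma> \<rho>" "substitution \<Sigma> \<rho>"
    using \<pi> by (auto simp: renaming_def substitution_def \<rho>_def fun_eq_iff)
  \<comment> \<open>The premises share no variables, so one substitution can act as
    \<open>\<sigma>\<close> on the first and, after undoing the renaming, as \<open>\<theta>\<close>
    on the second. It unifies \<open>l \<cdot> \<rho>\<close> with \<open>u\<close>.\<close>
  define \<tau> where "\<tau> x = (if x \<in> vars_trm s \<union> vars_trm t then \<sigma> x else \<theta> (inv \<pi> x))" for x
  have inv: "\<pi> (inv \<pi> x) = x" "inv \<pi> (\<pi> x) = x" for x
    using \<pi>(1) by (auto simp: bij_def surj_f_inv_f)
  have \<tau>: "substitution \<Sigma> \<tau>"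
    unfolding substitution_def
  proof
    fix x
    show "well_sorted \<Sigma> (\<tau> x) \<and> sort_of \<Sigma> (\<tau> x) = var_sort \<Sigma> x"
      using \<pi>(2)[of "inv \<pi> x"] inv(1)[of x] st(2) lr(2) by (simp add: \<tau>_def substitutionD)
  qed
  have \<tau>_st: "s \<cdot> \<tau> = s \<cdot> \<sigma>" "t \<cdot> \<tau> = t \<cdot> \<sigma>" "u \<cdot> \<tau> = u \<cdot> \<sigma>"
    using vars_trm_at[OF u(1)] by (auto simp: \<tau>_def intro!: subst_trm_cong)
  have \<tau>_lr: "l \<cdot> \<rho> \<cdot> \<tau> = l \<cdot> \<theta>" "r \<cdot> \<rho> \<cdot> \<tau> = r \<cdot> \<theta>"
  proof -
    have "\<tau> (\<pi> x) = \<theta> x" if "x \<in> vars_trm l \<union> vars_trm r" for x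
      using that \<pi>(3) inv(2)[of x] unfolding \<tau>_def by (metis IntI empty_iff imageI)
    then show "l \<cdot> \<rho> \<cdot> \<tau> = l \<cdot> \<theta>" "r \<cdot> \<rho> \<cdot> \<tau> = r \<cdot> \<theta>"
      unfolding subst_trm_comp by (auto simp: \<rho>_def intro!: subst_trm_cong)
  qed
  have ws: "well_sorted \<Sigma> (l \<cdot> \<rho>)" "well_sorted \<Sigma> u"
    using plain_eq_well_sorted[OF lr(1)] plain_eq_well_sorted[OF st(1)] well_sorted_trm_at[OF u(1)] \<rho>(2)
    by auto
  have unif: "l \<cdot> \<rho> \<cdot> \<tau> = u \<cdot> \<tau>"
    using \<tau>_lr \<tau>_st u(3) by simp
  then obtain \<mu> where mgu: "is_mgu \<Sigma> \<mu> (l \<cdot> \<rho>) u"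
    using is_mgu_exists[OF ws \<tau>] by blast
  \<comment> \<open>\<open>\<tau>\<close> factors through \<open>\<mu>\<close>; the remaining factor
    \<open>\<delta>\<close> turns the conclusion into the critical pair, and the ordering conditions
    are reflected along it.\<close>
  then obtain \<delta> where \<delta>: "substitution \<Sigma> \<delta>" "\<And>x. \<tau> x = \<mu> x \<cdot> \<delta>"
    unfolding is_mgu_def using unif \<tau> by blast
  have inst: "v \<cdot> \<mu> \<cdot> \<delta> = v \<cdot> \<tau>" for v
    unfolding subst_trm_comp by (rule subst_trm_cong) (simp add: \<delta>(2))
  define Q where "Q = subst_clause Q0 \<rho>"
  have P0: "length P = 1" "same_lit (P ! 0) (Lit True s t)" "vars_clause P = vars_trm s \<union> vars_trm t"
    using P(2) by (auto simp: is_equation_iff same_lit_Lit vars_clause_def)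
  have "vars_trm (v \<cdot> \<rho>) = \<pi> ` vars_trm v" for v
    by (auto simp: vars_subst_trm \<rho>_def)
  then have Q: "length Q0 = 1" "length Q = 1" "same_lit (Q ! 0) (Lit True (l \<cdot> \<rho>) (r \<cdot> \<rho>))"
    "vars_clause Q = \<pi> ` (vars_trm l \<union> vars_trm r)"
    using Q0(2) by (auto simp: is_equation_iff same_lit_Lit vars_clause_def Q_def subst_clause_def)
  have "ReC \<Sigma> gt sel N Plain []
     (subst_clause (Lit True (put_trm s k (r \<cdot> \<rho>)) t # nths P (- {0}) @ nths Q (- {0})) \<mu>)"
  proof (rule ReC.Sup[OF P(1) Q0(1) _ _ P0(2) _ _ \<rho>(1) Q_def _ Q(3) u(1,2) mgu])
    show "0 \<in> sel P" "0 \<in> sel Q0"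
      using selected_unit unit P(1) Q0(1) by blast+
    show "vars_clause P \<inter> vars_clause Q = {}"
      using \<pi>(3) by (auto simp: P0 Q)
    show "\<not> geq gt (r \<cdot> \<rho> \<cdot> \<mu>) (l \<cdot> \<rho> \<cdot> \<mu>)"
      using lr(3) \<delta>(1) by (intro ord_imp_not_geq_general[of _ \<delta>]) (auto simp: inst \<tau>_lr)
    show "\<not> geq gt (t \<cdot> \<mu>) (s \<cdot> \<mu>)"
      using st(3) \<delta>(1) by (intro ord_imp_not_geq_general[of _ \<delta>]) (auto simp: inst \<tau>_st)
  qed (use P0 Q in auto)
  moreover have "nths P (- {0}) = []" "nths Q (- {0}) = []"
    using P0(1) Q(2) by (auto simp: length_Suc_conv)
  ultimately have "plain_eq (put_trm s k (r \<cdot> \<rho>) \<cdot> \<mu>) (t \<cdot> \<mu>)"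
    by (auto simp: plain_eq_def is_equation_iff subst_clause_def)
  moreover have "put_trm s k (r \<cdot> \<rho>) \<cdot> \<mu> \<cdot> \<delta> = put_trm (s \<cdot> \<sigma>) k (r \<cdot> \<theta>)"
    using put_trm_subst[OF u(1), of "r \<cdot> \<rho>" \<tau>] by (simp only: inst \<tau>_st \<tau>_lr)
  moreover have "t \<cdot> \<mu> \<cdot> \<delta> = t \<cdot> \<sigma>"
    by (simp add: inst \<tau>_st)
  ultimately show ?thesis
    using \<delta>(1) by blast
qed

text \<open>The usual distinction between overlaps at or below a variable and proper overlaps. In
  the first case the occurrences of \<open>x\<close> that the step did not touch are rewritten
  afterwards.\<close>

lemma step_instance_cases:
  assumes "step (s \<cdot> \<sigma>) c" "well_sorted \<Sigma> s" "substitution \<Sigma> \<sigma>"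
  shows "(\<exists>x w. step (\<sigma> x) w \<and> step\<^sup>*\<^sup>* c (s \<cdot> \<sigma>(x := w))) \<or>
    (\<exists>k u l r \<theta>. trm_at s k = Some u \<and> (\<nexists>x. u = Var x) \<and> plain_eq l r \<and> substitution \<Sigma> \<theta> \<and>
       u \<cdot> \<sigma> = l \<cdot> \<theta> \<and> ord (l \<cdot> \<theta>) (r \<cdot> \<theta>) \<and> c = put_trm (s \<cdot> \<sigma>) k (r \<cdot> \<theta>))"
  using assms(1,2)
proof (induction s arbitrary: c)
  case (Var x)
  then show ?case by auto
next
  case (Fun f ss)
  from Fun.prems(1) show ?case
  proof (cases rule: step.cases)
    case (root l r \<theta>)
    then show ?thesis
      by (intro disjI2 exI[of _ "[]"] exI[of _ "Fun f ss"] exI[of _ l] exI[of _ r] exI[of _ \<theta>]) auto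
  next
    case (arg a b g xs ys)
    then have "map (\<lambda>t. t \<cdot> \<sigma>) ss = xs @ a # ys" and g: "g = f" by auto
    then obtain ss1 s ss2 where ss: "ss = ss1 @ s # ss2" and xs: "xs = map (\<lambda>t. t \<cdot> \<sigma>) ss1"
      and a: "a = s \<cdot> \<sigma>" and ys: "ys = map (\<lambda>t. t \<cdot> \<sigma>) ss2"
      by (auto simp: map_eq_append_conv map_eq_Cons_conv)
    have ws: "well_sorted \<Sigma> t" if "t \<in> set ss" for t
      using that Fun.prems(2) by simp
    have "s \<in> set ss" "step (s \<cdot> \<sigma>) b" "well_sorted \<Sigma> s"
      using arg ws by (auto simp: ss a)
    then have
      "(\<exists>x w. step (\<sigma> x) w \<and> step\<^sup>*\<^sup>* b (s \<cdot> \<sigma>(x := w))) \<or>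
       (\<exists>k u l r \<theta>. trm_at s k = Some u \<and> (\<nexists>x. u = Var x) \<and> plain_eq l r \<and> substitution \<Sigma> \<theta> \<and>
         u \<cdot> \<sigma> = l \<cdot> \<theta> \<and> ord (l \<cdot> \<theta>) (r \<cdot> \<theta>) \<and> b = put_trm (s \<cdot> \<sigma>) k (r \<cdot> \<theta>))"
      by (rule Fun.IH)
    then show ?thesis
    proof (elim disjE exE conjE)
      \<comment> \<open>The argument \<open>b\<close> is continued by the induction hypothesis, the
        others by rewriting their own occurrences of \<open>x\<close>.\<close>
      fix x w assume w: "step (\<sigma> x) w" "step\<^sup>*\<^sup>* b (s \<cdot> \<sigma>(x := w))"
      have "step\<^sup>*\<^sup>* (t \<cdot> \<sigma>) (t \<cdot> \<sigma>(x := w))" if "t \<in> set ss" for t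
        using w(1) ws[OF that] assms(3) by (intro steps_subst) auto
      then have "list_all2 step\<^sup>*\<^sup>* (xs @ b # ys) (map (\<lambda>t. t \<cdot> \<sigma>(x := w)) ss)"
        using w(2) by (auto simp: ss xs ys list_all2_map1 list_all2_map2 intro!: list_all2_appendI list.rel_refl_strong)
      then have "step\<^sup>*\<^sup>* (Fun f ([] @ xs @ b # ys)) (Fun f ([] @ map (\<lambda>t. t \<cdot> \<sigma>(x := w)) ss))"
        using step_well_sorted[OF Fun.prems(1)] arg g by (intro steps_args) auto
      moreover have "c = Fun f ([] @ xs @ b # ys)"
        using arg g by simp
      ultimately have "step\<^sup>*\<^sup>* c (Fun f ss \<cdot> \<sigma>(x := w))"
        by simp
      then show ?thesis
        using w(1) by blast
    next
      fix k u l r \<theta>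
      assume k: "trm_at s k = Some u" "\<nexists>x. u = Var x" "plain_eq l r" "substitution \<Sigma> \<theta>"
         "u \<cdot> \<sigma> = l \<cdot> \<theta>" "ord (l \<cdot> \<theta>) (r \<cdot> \<theta>)" "b = put_trm (s \<cdot> \<sigma>) k (r \<cdot> \<theta>)"
      have "c = put_trm (Fun f ss \<cdot> \<sigma>) (Suc (length ss1) # k) (r \<cdot> \<theta>)"
        using arg g k(7) by (simp add: ss xs ys a nth_append list_update_append)
      moreover have "trm_at (Fun f ss) (Suc (length ss1) # k) = Some u"
        using k(1) by (simp add: ss nth_append)
      ultimately show ?thesis
        using k by blast
    qed
  qed
qed

abbreviation joinable :: "('f, 'v) trm \<Rightarrow> ('f, 'v) trm \<Rightarrow> bool" where
  "joinable a b \<equiv> \<exists>c. step\<^sup>*\<^sup>* a c \<and> step\<^sup>*\<^sup>* b c"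

text \<open>In a variable overlap the step is repeated at all occurrences of \<open>x\<close> on
  both sides, and the new instance of the equation closes the peak. In a proper overlap an instance
  of a superposition conclusion closes it.\<close>

lemma root_peak:
  assumes "plain_eq s t" "substitution \<Sigma> \<sigma>" "ord (s \<cdot> \<sigma>) (t \<cdot> \<sigma>)" "step (s \<cdot> \<sigma>) c"
  shows "joinable (t \<cdot> \<sigma>) c"
proof -
  have ws: "well_sorted \<Sigma> s" "well_sorted \<Sigma> t"
    using plain_eq_well_sorted[OF assms(1)] by auto
  from step_instance_cases[OF assms(4) ws(1) assms(2)] show ?thesis
  proof (elim disjE exE conjE)
    fix x w assume w: "step (\<sigma> x) w" "step\<^sup>*\<^sup>* c (s \<cdot> \<sigma>(x := w))"
    have "substitution \<Sigma> (\<sigma>(x := w))"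
      using step_well_sorted[OF w(1)] assms(2) by (intro substitution_upd) (auto simp: substitutionD)
    \<comment> \<open>The instance under \<open>\<sigma>(x := w)\<close> may be trivial or oriented
      from \<open>t\<close> to \<open>s\<close>; every outcome joins the two terms.\<close>
    then have "joinable (t \<cdot> \<sigma>(x := w)) (s \<cdot> \<sigma>(x := w))"
      using plain_eq_instance[OF assms(1)] by (metis r_into_rtranclp rtranclp.rtrancl_refl)
    moreover have "step\<^sup>*\<^sup>* (t \<cdot> \<sigma>) (t \<cdot> \<sigma>(x := w))"
      using w(1) ws assms(2) by (intro steps_subst) auto
    ultimately show ?thesis
      using w(2) by (meson rtranclp_trans)
  next
    fix k u l r \<theta>
    assume k: "trm_at s k = Some u" "\<nexists>x. u = Var x" "plain_eq l r" "substitution \<Sigma> \<theta>"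
      "u \<cdot> \<sigma> = l \<cdot> \<theta>" "ord (l \<cdot> \<theta>) (r \<cdot> \<theta>)" "c = put_trm (s \<cdot> \<sigma>) k (r \<cdot> \<theta>)"
    obtain s' t' \<delta> where "plain_eq s' t'" "substitution \<Sigma> \<delta>" "s' \<cdot> \<delta> = c" "t' \<cdot> \<delta> = t \<cdot> \<sigma>"
      using critical_overlap[OF assms(1-3) k(3,4,6,1,2,5)] k(7) by metis
    then show ?thesis
      using plain_eq_instance by (metis r_into_rtranclp rtranclp.rtrancl_refl)
  qed
qed

text \<open>Steps in different arguments commute, steps in the same argument are joined by the
  induction hypothesis, and \<open>root_peak\<close> covers a root step on either side.\<close>

lemma step_locally_confluent: "step a b \<Longrightarrow> step a c \<Longrightarrow> joinable b c"
proof (induction arbitrary: c rule: step.induct)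
  case (root l r \<theta>)
  then show ?case by (rule root_peak)
next
  case (arg s t f xs ys)
  note hyps = arg.hyps and IH = arg.IH and prems = arg.prems
  from prems show ?case
  proof (cases rule: step.cases)
    case (root l r \<theta>)
    have "step (l \<cdot> \<theta>) (Fun f (xs @ t # ys))"
      using step.arg[OF arg.hyps] root(1) by metis
    then show ?thesis
      using root_peak[OF root(3-5)] root(2) by metis
  next
    case (arg u v us vs)
    have ws: "well_sorted \<Sigma> (Fun f (xs @ t # ys))" "well_sorted \<Sigma> (Fun f (us @ v # vs))"
      using step_well_sorted[OF step.arg[OF hyps]] step_well_sorted[OF prems] arg by auto
    have eq: "xs @ s # ys = us @ u # vs" using arg by auto
    then consider (same) "xs = us" "s = u" "ys = vs"
      | (left) zs where "us = xs @ s # zs" "ys = zs @ u # vs"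
      | (right) zs where "xs = us @ u # zs" "vs = zs @ s # ys"
      by (auto simp: append_eq_append_conv2 append_eq_Cons_conv Cons_eq_append_conv)
    then show ?thesis
    proof cases
      case same
      obtain w where w: "step\<^sup>*\<^sup>* t w" "step\<^sup>*\<^sup>* v w"
        using IH[of v] same arg by auto
      show ?thesis
        using steps_arg[OF w(1) ws(1)] steps_arg[OF w(2) ws(2)] same arg eq by auto
    next
      case left
      have "step (Fun f ((xs @ t # zs) @ u # vs)) (Fun f ((xs @ t # zs) @ v # vs))"
        using arg ws left by (intro step.arg) auto
      moreover have "step (Fun f (xs @ s # (zs @ v # vs))) (Fun f (xs @ t # (zs @ v # vs)))"
        using hyps ws left by (intro step.arg) auto
      ultimately show ?thesis
        using left arg eq by auto
    next
      case right
      have "step (Fun f ((us @ v # zs) @ s # ys)) (Fun f ((us @ v # zs) @ t # ys))"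
        using hyps ws right by (intro step.arg) auto
      moreover have "step (Fun f (us @ u # (zs @ t # ys))) (Fun f (us @ v # (zs @ t # ys)))"
        using arg ws right by (intro step.arg) auto
      ultimately show ?thesis
        using right arg eq by auto
    qed
  qed
qed

lemma step_Church_Rosser: "equivclp step a b \<Longrightarrow> joinable a b"
  using semiconfluentp_equivclp[OF confluentp_imp_semiconfluentp[OF newman[OF step_wf step_locally_confluent]]]
  by (auto simp: rtranclp_conversep)


subsection \<open>Derivability is convertibility\<close>

text \<open>As \<open>ord\<close> extends \<open>gt\<close>, its steps meet the condition of
  downward rewriting. The left-hand side is reduced first; \<open>ReC_rewrite_down\<close> takes
  care of the order of positions.\<close>

lemma plain_steps:
  assumes "step\<^sup>*\<^sup>* s s'" "step\<^sup>*\<^sup>* t t'" "ReC \<Sigma> gt sel N Plain p [Lit True s t]"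
  shows "\<exists>p. ReC \<Sigma> gt sel N Plain p [Lit True s' t']"
proof -
  have "\<exists>p. ReC \<Sigma> gt sel N Plain p [Lit True s' t]"
    using assms(1)
  proof (induction rule: rtranclp_induct)
    case (step a b)
    then obtain p k l r \<theta> where p: "ReC \<Sigma> gt sel N Plain p [Lit True a t]"
      and k: "plain_eq l r" "substitution \<Sigma> \<theta>" "ord (l \<cdot> \<theta>) (r \<cdot> \<theta>)"
      "trm_at a k = Some (l \<cdot> \<theta>)" "b = put_trm a k (r \<cdot> \<theta>)"
      using step_position[OF step.hyps(2)] by blast
    obtain q E where "ReC \<Sigma> gt sel N Plain q E" "is_equation E l r"
      using k(1) by (auto simp: plain_eq_def)
    \<comment> \<open>The first literal and its first side are selected before \<open>k\<close>; the
      right-hand side has \<open>1 # 2 # k\<close>.\<close>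
    from ReC_rewrite_down[OF p this k(2), of "1 # 1 # k"] show ?case
      using k ord_imp_not_geq by auto
  qed (use assms in blast)
  then obtain p where p: "ReC \<Sigma> gt sel N Plain p [Lit True s' t]" by blast
  show ?thesis
    using assms(2)
  proof (induction rule: rtranclp_induct)
    case (step a b)
    then obtain p k l r \<theta> where p: "ReC \<Sigma> gt sel N Plain p [Lit True s' a]"
      and k: "plain_eq l r" "substitution \<Sigma> \<theta>" "ord (l \<cdot> \<theta>) (r \<cdot> \<theta>)"
      "trm_at a k = Some (l \<cdot> \<theta>)" "b = put_trm a k (r \<cdot> \<theta>)"
      using step_position[OF step.hyps(2)] by blast
    obtain q E where "ReC \<Sigma> gt sel N Plain q E" "is_equation E l r"
      using k(1) by (auto simp: plain_eq_def)
    from ReC_rewrite_down[OF p this k(2), of "1 # 2 # k"] show ?case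
      using k ord_imp_not_geq by auto
  qed (use p in blast)
qed

text \<open>Each step is undone upward by the same equation read from right to left. The induction
  starts at the reduced terms, where derivability is known.\<close>

lemma derivable_converse_steps:
  assumes "step\<^sup>*\<^sup>* s s'" "step\<^sup>*\<^sup>* t t'" "derivable \<Sigma> gt sel N [Lit True s' t']"
  shows "derivable \<Sigma> gt sel N [Lit True s t]"
proof -
  have s: "derivable \<Sigma> gt sel N [Lit True s t']"
    using assms(1)
  proof (induction rule: converse_rtranclp_induct)
    case (step a b)
    then obtain k l r \<theta> where k: "plain_eq l r" "substitution \<Sigma> \<theta>" "ord (l \<cdot> \<theta>) (r \<cdot> \<theta>)"
      "trm_at b k = Some (r \<cdot> \<theta>)" "a = put_trm b k (l \<cdot> \<theta>)"
      using step_position[OF step.hyps(1)] by blast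
    obtain q E where "ReC \<Sigma> gt sel N Plain q E" "is_equation E r l"
      using plain_eq_sym[OF k(1)] by (auto simp: plain_eq_def)
    from ReC_rewrite_up[OF step.IH this k(2), of "1 # 1 # k"] show ?case
      using k ord_imp_not_geq by auto
  qed (use assms in blast)
  show ?thesis
    using assms(2)
  proof (induction rule: converse_rtranclp_induct)
    case (step a b)
    then obtain k l r \<theta> where k: "plain_eq l r" "substitution \<Sigma> \<theta>" "ord (l \<cdot> \<theta>) (r \<cdot> \<theta>)"
      "trm_at b k = Some (r \<cdot> \<theta>)" "a = put_trm b k (l \<cdot> \<theta>)"
      using step_position[OF step.hyps(1)] by blast
    obtain q E where "ReC \<Sigma> gt sel N Plain q E" "is_equation E r l"
      using plain_eq_sym[OF k(1)] by (auto simp: plain_eq_def)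
    from ReC_rewrite_up[OF step.IH this k(2), of "1 # 2 # k"] show ?case
      using k ord_imp_not_geq by auto
  qed (use s in blast)
qed

text \<open>The invariant of upward rewriting: its results admit no more downward rewrites, but each
  stays tied, side by side, to a \<open>Plain\<close> equation.\<close>

definition convertible :: "('f, 'v) clause \<Rightarrow> bool" where
  "convertible C \<longleftrightarrow> (\<exists>p s t s' t'. C = [Lit True s' t'] \<and> ReC \<Sigma> gt sel N Plain p [Lit True s t] \<and>
     equivclp step s s' \<and> equivclp step t t')"

lemma convertible_put:
  assumes "convertible C" "unit_equation \<Sigma> C" "plain_eq l r" "substitution \<Sigma> \<theta>"
    "clause_at C q = Some (l \<cdot> \<theta>)"
  shows "convertible (put_clause C q (r \<cdot> \<theta>))"
proof -
  obtain p s t u v where C: "C = [Lit True u v]" and p: "ReC \<Sigma> gt sel N Plain p [Lit True s t]"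
    "equivclp step s u" "equivclp step t v"
    using assms(1) by (auto simp: convertible_def)
  have ws: "well_sorted \<Sigma> u" "well_sorted \<Sigma> v"
    using assms(2) C by (auto simp: unit_equation_def)
  show ?thesis
    using assms(5)[unfolded C]
  proof (cases rule: clause_at_unit_cases)
    case (1 k)
    then show ?thesis
      using p equivclp_step_put[OF assms(3,4) 1(2) ws(1)]
      by (auto simp: convertible_def C intro: equivclp_trans)
  next
    case (2 k)
    then show ?thesis
      using p equivclp_step_put[OF assms(3,4) 2(2) ws(2)]
      by (auto simp: convertible_def C intro: equivclp_trans)
  qed
qed

lemma plain_convertible:
  assumes "ReC \<Sigma> gt sel N Plain p C"
  shows "convertible C"
proof -
  obtain s t where "C = [Lit True s t]"
    using unit[OF assms] by (auto simp: unit_equation_def)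
  then show ?thesis
    using assms unfolding convertible_def by (blast intro: equivclp_refl)
qed

text \<open>Only \<open>RwUp\<close> yields \<open>Upward\<close>, and it rewrites by a
  \<open>Plain\<close> equation, which is a conversion; a premise of either annotation is
  convertible already.\<close>

lemma ReC_convertible:
  assumes "ReC \<Sigma> gt sel N a p C"
  shows "convertible C"
  using assms
proof (cases a)
  case Upward
  show ?thesis
    using assms unfolding Upward
  proof (induction Upward p C rule: ReC.induct)
    case (RwUp a p C p' E l r \<theta> q)
    have "convertible C"
      using RwUp by (cases a) (auto intro: plain_convertible)
    then show ?case
      using RwUp convertible_put unit unfolding plain_eq_def by blast
  qed
qed (use plain_convertible in blast)

text \<open>The derivation of \<open>C\<close> cannot simply be extended, since \<open>C\<close> may
  be \<open>Upward\<close> and the rewrite downward. Only the \<open>Plain\<close> equation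
  convertible to \<open>C\<close> is kept, and a new derivation starts from it.\<close>

lemma derivable_put:
  assumes "derivable \<Sigma> gt sel N C" "plain_eq l r" "substitution \<Sigma> \<theta>"
    "clause_at C q = Some (l \<cdot> \<theta>)"
  shows "derivable \<Sigma> gt sel N (put_clause C q (r \<cdot> \<theta>))"
proof -
  have "unit_equation \<Sigma> C" "convertible C"
    using assms(1) unit ReC_convertible by (auto simp: derivable_def)
  then obtain p s t s' t' where C: "put_clause C q (r \<cdot> \<theta>) = [Lit True s' t']"
    and p: "ReC \<Sigma> gt sel N Plain p [Lit True s t]" and "equivclp step s s'" "equivclp step t t'"
    using convertible_put[OF _ _ assms(2-4)] unfolding convertible_def by blast
  \<comment> \<open>The sides are joined separately; \<open>u\<close> and \<open>v\<close> mark the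
    turn from the downward to the upward phase.\<close>
  then obtain u v where u: "step\<^sup>*\<^sup>* s u" "step\<^sup>*\<^sup>* s' u" and v: "step\<^sup>*\<^sup>* t v" "step\<^sup>*\<^sup>* t' v"
    using step_Church_Rosser by blast
  have "derivable \<Sigma> gt sel N [Lit True u v]"
    using plain_steps[OF u(1) v(1) p] by (auto simp: derivable_def)
  then show ?thesis
    unfolding C using u(2) v(2) derivable_converse_steps by blast
qed

end

section \<open>Equational derivability\<close>

theorem theorem4:
  fixes \<Sigma> :: "('f, 'v, 's) signature"
    and gt :: "('f, 'v) trm \<Rightarrow> ('f, 'v) trm \<Rightarrow> bool"
    and sel :: "('f, 'v) clause \<Rightarrow> nat set"
    and \<C> :: "('f, 'v) clause set"
    and D E :: "('f, 'v) clause"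
    and l r :: "('f, 'v) trm"
    and \<theta> :: "('f, 'v) subst"
    and q :: pos
  assumes "wf_signature \<Sigma>"
    and "reduction_ordering \<Sigma> gt"
    and "total_on_ground \<Sigma> gt"
    and "selection_function \<Sigma> gt sel"
    and "substitution \<Sigma> \<theta>"
    and "\<And>C. C \<in> \<C> \<Longrightarrow> well_sorted_clause \<Sigma> C \<and> (\<exists>s t. is_equation C s t)"
    and "well_sorted_clause \<Sigma> E" and "is_equation E l r"
    and "clause_at D q = Some (l \<cdot> \<theta>)"
    and "derivable \<Sigma> gt sel \<C> D"
  shows "derivable \<Sigma> gt sel (insert E \<C>) (put_clause D q (r \<cdot> \<theta>))"
proof -
  obtain ord where ord:
    "\<And>s t. gt s t \<Longrightarrow> ord s t"
    "wfp (\<lambda>s t. ord t s)"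
    "\<And>s t. well_sorted \<Sigma> s \<Longrightarrow> well_sorted \<Sigma> t \<Longrightarrow> s = t \<or> ord s t \<or> ord t s"
    "\<And>f xs s t ys. ord s t \<Longrightarrow> well_sorted \<Sigma> (Fun f (xs @ s # ys)) \<Longrightarrow>
       well_sorted \<Sigma> (Fun f (xs @ t # ys)) \<Longrightarrow> ord (Fun f (xs @ s # ys)) (Fun f (xs @ t # ys))"
    using total_extension[OF assms(1-3)] by blast
  have unit: "unit_equation \<Sigma> C" if "well_sorted_clause \<Sigma> C" "is_equation C s t" for C s t
    using that by (auto simp: unit_equation_def is_equation_iff well_sorted_clause_def)
  \<comment> \<open>Over the extended set, \<open>l\<close> and \<open>r\<close> form a derivable
    equation as an input; the derivation of \<open>D\<close> is transferred by monotonicity.\<close>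
  interpret equational_ReC \<Sigma> gt ord sel "insert E \<C>"
    using assms(1,2,4) ord
  proof unfold_locales
    show "unit_equation \<Sigma> C" if "C \<in> insert E \<C>" for C
      using that assms(6-8) unit by blast
  qed assumption+
  have "plain_eq l r"
    using assms(8) by (auto simp: plain_eq_def intro: ReC.Input)
  moreover have "derivable \<Sigma> gt sel (insert E \<C>) D"
    using assms(10) derivable_mono by blast
  ultimately show ?thesis
    using derivable_put assms(5,9) by blast
qed

end
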